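(* Let $\mathbf{c} = (c_j)_{j=1}^m$ with $c_j > 0$, let $\mathbf{B} = (B_j)_{j=1}^m \in \mathcal{F}(\mathbf{c})$ and let $\varepsilon > 0$. Then there exist $\widetilde{\mathbf{B}} \in [\mathbf{B}]$ and $\mathbf{G} \in \mathcal{G}(\mathbf{c})$ such that $$\|\widetilde{\mathbf{B}} - \mathbf{G}\| < \varepsilon.$$
   Context: Fix positive integers $m, n, n_1, \ldots, n_m$. An $m$-transformation is a tuple $\mathbf{B} = (B_j)_{j=1}^m$ of linear maps $B_j : \mathbb{R}^n \to \mathbb{R}^{n_j}$, and an $m$-exponent is a tuple $\mathbf{c} = (c_j)_{j=1}^m$ of real numbers $c_j > 0$. $B_j^*$ denotes the adjoint (transpose) with respect to the standard inner products. $\|\cdot\|$ is a fixed (arbitrary) norm on the finite-dimensional real vector space of $m$-transformations. The Brascamp--Lieb constant is $$\mathrm{BL}(\mathbf{B},\mathbf{c}) = \sup_{\mathbf{f}} \frac{\int_{\mathbb{R}^n} \prod_{j=1}^m f_j(B_jx)^{c_j}\,dx}{\prod_{j=1}^m \big(\int_{\mathbb{R}^{n_j}} f_j\big)^{c_j}} \in [0,\infty],$$ where the supremum is over all tuples $\mathbf{f} = (f_j)_{j=1}^m$ of non-negative integrable functions $f_j$ on $\mathbb{R}^{n_j}$ with $\int_{\mathbb{R}^{n_j}} f_j \in (0,\infty)$. Two $m$-transformations $\mathbf{B}$, $\widetilde{\mathbf{B}}$ are equivalent if there are invertible linear maps $T : \mathbb{R}^n \to \mathbb{R}^n$ and $T_j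 : \mathbb{R}^{n_j} \to \mathbb{R}^{n_j}$ such that $\widetilde{B}_j = T_j^{-1} B_j T$ for all $j \in \{1,\ldots,m\}$; $[\mathbf{B}]$ denotes the equivalence class of $\mathbf{B}$. $\mathcal{F}(\mathbf{c})$ is the set of $m$-transformations $\mathbf{B}$ with $\mathrm{BL}(\mathbf{B},\mathbf{c}) < \infty$ and $B_jB_j^* = I_{n_j}$ for all $j$. $\mathcal{G}(\mathbf{c})$ is the set of $m$-transformations $\mathbf{G}$ such that $(\mathbf{G},\mathbf{c})$ is geometric, i.e. $G_jG_j^* = I_{n_j}$ for all $j$ and $\sum_{j=1}^m c_j G_j^*G_j = I_n$. *)

theory Defs
  imports "HOL-Analysis.Analysis" "Jordan_Normal_Form.Matrix"
begin

text \<open>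
  The space of points of \<open>\<real>\<^sup>k\<close> is \<open>carrier_vec k\<close>, and a linear map from \<open>\<real>\<^sup>n\<close> to
  \<open>\<real>\<^sup>k\<close> is its matrix in \<open>carrier_mat k n\<close>, so that the adjoint with respect to the
  standard inner products is \<open>transpose_mat\<close>.

  An \<open>m\<close>-tuple indexed by \<open>1, \<dots>, m\<close> is a function on the index set \<open>{..<m}\<close>; the
  dimensions \<open>n\<^sub>1, \<dots>, n\<^sub>m\<close> are given by \<open>d :: nat \<Rightarrow> nat\<close>.
\<close>

text \<open>
  Lebesgue measure (on the Borel sets) of \<open>\<real>\<^sup>k\<close>: the \<open>k\<close>-fold product of \<open>lborel\<close>,
  transported along the bijection \<open>vec k\<close> from \<open>{..<k} \<rightarrow>\<^sub>E UNIV\<close> to \<open>carrier_vec k\<close>.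
\<close>

definition lborel_vec :: "nat \<Rightarrow> real vec measure" where
  "lborel_vec k = embed_measure (\<Pi>\<^sub>M i\<in>{..<k}. lborel) (Matrix.vec k)"


definition mtrans :: "nat \<Rightarrow> nat \<Rightarrow> (nat \<Rightarrow> nat) \<Rightarrow> (nat \<Rightarrow> real mat) set" where
  "mtrans m n d = (\<Pi>\<^sub>E j\<in>{..<m}. carrier_mat (d j) n)"

definition mt_zero :: "nat \<Rightarrow> nat \<Rightarrow> (nat \<Rightarrow> nat) \<Rightarrow> nat \<Rightarrow> real mat" where
  "mt_zero m n d = (\<lambda>j\<in>{..<m}. 0\<^sub>m (d j) n)"

definition mt_add :: "nat \<Rightarrow> (nat \<Rightarrow> real mat) \<Rightarrow> (nat \<Rightarrow> real mat) \<Rightarrow> nat \<Rightarrow> real mat" where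
  "mt_add m A B = (\<lambda>j\<in>{..<m}. A j + B j)"

definition mt_diff :: "nat \<Rightarrow> (nat \<Rightarrow> real mat) \<Rightarrow> (nat \<Rightarrow> real mat) \<Rightarrow> nat \<Rightarrow> real mat" where
  "mt_diff m A B = (\<lambda>j\<in>{..<m}. A j - B j)"

definition mt_scale :: "nat \<Rightarrow> real \<Rightarrow> (nat \<Rightarrow> real mat) \<Rightarrow> nat \<Rightarrow> real mat" where
  "mt_scale m a A = (\<lambda>j\<in>{..<m}. a \<cdot>\<^sub>m A j)"

definition mt_norm :: "nat \<Rightarrow> nat \<Rightarrow> (nat \<Rightarrow> nat) \<Rightarrow> ((nat \<Rightarrow> real mat) \<Rightarrow> real) \<Rightarrow> bool" where
  "mt_norm m n d N \<longleftrightarrow>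
     (\<forall>A\<in>mtrans m n d. 0 \<le> N A \<and> (N A = 0 \<longleftrightarrow> A = mt_zero m n d)) \<and>
     (\<forall>A\<in>mtrans m n d. \<forall>a. N (mt_scale m a A) = \<bar>a\<bar> * N A) \<and>
     (\<forall>A\<in>mtrans m n d. \<forall>B\<in>mtrans m n d. N (mt_add m A B) \<le> N A + N B)"


definition BL_input :: "nat \<Rightarrow> (nat \<Rightarrow> nat) \<Rightarrow> (nat \<Rightarrow> real vec \<Rightarrow> real) \<Rightarrow> bool" where
  "BL_input m d f \<longleftrightarrow>
     (\<forall>j<m. (\<forall>y\<in>carrier_vec (d j). 0 \<le> f j y) \<and>
            integrable (lborel_vec (d j)) (f j) \<and>
            0 < integral\<^sup>L (lborel_vec (d j)) (f j))"

text \<open>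
  The numerator may be infinite, hence the \<open>ennreal\<close>-valued integral.
\<close>

definition BL_const ::
    "nat \<Rightarrow> nat \<Rightarrow> (nat \<Rightarrow> nat) \<Rightarrow> (nat \<Rightarrow> real mat) \<Rightarrow> (nat \<Rightarrow> real) \<Rightarrow> ennreal" where
  "BL_const m n d B c =
     (SUP f\<in>{f. BL_input m d f}.
        (\<integral>\<^sup>+ x. ennreal (\<Prod>j<m. f j (B j *\<^sub>v x) powr c j) \<partial>lborel_vec n) /
        ennreal (\<Prod>j<m. (integral\<^sup>L (lborel_vec (d j)) (f j)) powr c j))"


text \<open>The equivalence class \<open>[B]\<close>; the matrix \<open>S j\<close> is the inverse of \<open>R j\<close>.\<close>

definition mt_class ::
    "nat \<Rightarrow> nat \<Rightarrow> (nat \<Rightarrow> nat) \<Rightarrow> (nat \<Rightarrow> real mat) \<Rightarrow> (nat \<Rightarrow> real mat) set" where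
  "mt_class m n d B =
     {B' \<in> mtrans m n d. \<exists>T R S.
        T \<in> carrier_mat n n \<and> invertible_mat T \<and>
        (\<forall>j<m. R j \<in> carrier_mat (d j) (d j) \<and> S j \<in> carrier_mat (d j) (d j) \<and>
               inverts_mat (R j) (S j) \<and> inverts_mat (S j) (R j) \<and>
               B' j = S j * B j * T)}"

definition BL_F :: "nat \<Rightarrow> nat \<Rightarrow> (nat \<Rightarrow> nat) \<Rightarrow> (nat \<Rightarrow> real) \<Rightarrow> (nat \<Rightarrow> real mat) set" where
  "BL_F m n d c =
     {B \<in> mtrans m n d. BL_const m n d B c < \<infinity> \<and>
        (\<forall>j<m. B j * transpose_mat (B j) = 1\<^sub>m (d j))}"

text \<open>The sum of the matrices \<open>c\<^sub>j G\<^sub>j\<^sup>* G\<^sub>j\<close> is written entrywise.\<close>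

definition BL_geometric ::
    "nat \<Rightarrow> nat \<Rightarrow> (nat \<Rightarrow> nat) \<Rightarrow> (nat \<Rightarrow> real mat) \<Rightarrow> (nat \<Rightarrow> real) \<Rightarrow> bool" where
  "BL_geometric m n d G c \<longleftrightarrow>
     (\<forall>j<m. G j * transpose_mat (G j) = 1\<^sub>m (d j)) \<and>
     Matrix.mat n n (\<lambda>(i, k). \<Sum>j<m. (c j \<cdot>\<^sub>m (transpose_mat (G j) * G j)) $$ (i, k)) = 1\<^sub>m n"

definition BL_G :: "nat \<Rightarrow> nat \<Rightarrow> (nat \<Rightarrow> nat) \<Rightarrow> (nat \<Rightarrow> real) \<Rightarrow> (nat \<Rightarrow> real mat) set" where
  "BL_G m n d c = {G \<in> mtrans m n d. BL_geometric m n d G c}"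

end

theory Submission
  imports Defs "HOL-Probability.Distributions" "Jordan_Normal_Form.Determinant"
begin

text \<open>
  Among the equivalent data \<open>X\<^sub>j = R\<^sub>j B\<^sub>j T\<close> with \<open>X\<^sub>j X\<^sub>j\<^sup>* = I\<close>, maximize
  \<open>v = (det T)\<^sup>2 \<Prod>\<^sub>j ((det R\<^sub>j)\<^sup>2 powr c\<^sub>j)\<close>. Put \<open>M = \<Sum>\<^sub>j c\<^sub>j X\<^sub>j\<^sup>* X\<^sub>j\<close>.
  Testing \<open>BL\<close> on Gaussians gives \<open>det M \<ge> \<kappa> v\<close> for some \<open>\<kappa> > 0\<close> and, by scaling, \<open>\<Sum>\<^sub>j c\<^sub>j n\<^sub>j = n\<close>;
  hence \<open>tr M = n\<close>, \<open>det M \<le> 1\<close>, and \<open>v\<close> is bounded. One Sinkhorn step (normalize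
  \<open>M\<close> to \<open>I\<close>, then make the \<open>X\<^sub>j\<close> coisometric again) multiplies \<open>v\<close> by at least \<open>1 / det M\<close>, so
  \<open>det M\<close> tends to \<open>1\<close> along a maximizing sequence. The \<open>X\<^sub>j\<close> stay in a compact set, and at a limit
  point \<open>tr M = n\<close> and \<open>det M = 1\<close>, which forces \<open>M = I\<close>.
\<close>

section \<open>Positive definite matrices and Gaussian integrals\<close>

text \<open>
  The factorization is \<open>M = L\<^sup>T L\<close> with \<open>L\<close> lower triangular, rather than \<open>L L\<^sup>T\<close>: the last variable then
  occurs only in the last entry of \<open>L x\<close>, so that Gaussian integrals can be evaluated by Fubini.
\<close>

lemma cholesky_entries:
  fixes M :: "nat \<Rightarrow> nat \<Rightarrow> real"
  assumes "\<And>i j. i < k \<Longrightarrow> j < k \<Longrightarrow> M i j = M j i"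
    and "\<And>x. (\<exists>i<k. x i \<noteq> 0) \<Longrightarrow> 0 < (\<Sum>i<k. \<Sum>j<k. M i j * x i * x j)"
  shows "\<exists>L. (\<forall>i<k. 0 < L i i) \<and> (\<forall>i j. i < j \<longrightarrow> L i j = 0) \<and>
             (\<forall>i<k. \<forall>j<k. M i j = (\<Sum>l<k. L l i * L l j))"
  using assms
proof (induction k arbitrary: M)
  case 0
  then show ?case by (intro exI[of _ "\<lambda>i j. 0"]) auto
next
  case (Suc k)
  note sym = Suc.prems(1) and pos = Suc.prems(2)
  \<comment> \<open>\<open>S\<close> is the Schur complement of the pivot \<open>a\<close>:
    completing the square in the last variable leaves exactly this form in the other
    variables.\<close>
  define a where "a = M k k"
  define S where "S = (\<lambda>i j. M i j - M i k * M k j / a)"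
  have a: "0 < a"
    using pos[of "\<lambda>i. if i = k then 1 else 0"] by (auto simp: a_def if_distrib sum.delta cong: if_cong)
  have "\<exists>L. (\<forall>i<k. 0 < L i i) \<and> (\<forall>i j. i < j \<longrightarrow> L i j = 0) \<and>
             (\<forall>i<k. \<forall>j<k. S i j = (\<Sum>l<k. L l i * L l j))"
  proof (rule Suc.IH)
    fix i j assume "i < k" "j < k"
    then show "S i j = S j i"
      using sym[of i j] sym[of i k] sym[of k j] by (simp add: S_def)
  next
    fix x :: "nat \<Rightarrow> real"
    assume x: "\<exists>i<k. x i \<noteq> 0"
    \<comment> \<open>\<open>y\<close> extends \<open>x\<close> by the last coordinate that
      minimizes the form of \<open>M\<close>. The minimum is the form of \<open>S\<close> at
      \<open>x\<close>, so \<open>S\<close> inherits definiteness.\<close>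
    define t where "t = (\<Sum>j<k. M k j * x j)"
    define y where "y = x(k := - t / a)"
    have sk: "M i k = M k i" if "i < k" for i using sym[of i k] that by simp
    have yi: "y i = x i" if "i < k" for i using that by (simp add: y_def)
    have yk: "y k = - t / a" by (simp add: y_def)
    have t': "(\<Sum>i<k. M i k * x i) = t" unfolding t_def by (intro sum.cong) (auto simp: sk)
    have "0 < (\<Sum>i<Suc k. \<Sum>j<Suc k. M i j * y i * y j)"
      using x by (intro pos) (auto simp: y_def intro!: less_SucI)
    also have "\<dots> = (\<Sum>i<k. (\<Sum>j<k. M i j * y i * y j) + M i k * y i * y k)
        + ((\<Sum>j<k. M k j * y k * y j) + M k k * y k * y k)"
      by simp
    also have "\<dots> = (\<Sum>i<k. \<Sum>j<k. M i j * x i * x j) + (\<Sum>i<k. M i k * x i * y k)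
        + ((\<Sum>j<k. M k j * x j * y k) + a * y k * y k)"
      by (simp add: yi sum.distrib a_def ac_simps)
    also have "\<dots> = (\<Sum>i<k. \<Sum>j<k. M i j * x i * x j) + (\<Sum>i<k. M i k * x i) * (- t / a)
        + ((\<Sum>j<k. M k j * x j) * (- t / a) + a * (- t / a) * (- t / a))"
      by (simp only: sum_distrib_right[symmetric] yk)
    also have "\<dots> = (\<Sum>i<k. \<Sum>j<k. M i j * x i * x j) - t * t / a"
      unfolding t' unfolding t_def[symmetric] using a by (simp add: field_simps power2_eq_square)
    also have "t * t = (\<Sum>i<k. \<Sum>j<k. (M i k * x i) * (M k j * x j))"
      using sum_product[of "\<lambda>i. M i k * x i" "{..<k}" "\<lambda>j. M k j * x j" "{..<k}"] t' t_def by simp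
    also have "(\<Sum>i<k. \<Sum>j<k. M i j * x i * x j) - \<dots> / a = (\<Sum>i<k. \<Sum>j<k. S i j * x i * x j)"
      by (simp add: S_def sum_divide_distrib sum_subtractf[symmetric] algebra_simps)
    finally show "0 < (\<Sum>i<k. \<Sum>j<k. S i j * x i * x j)" .
  qed
  then obtain L where L: "\<And>i. i < k \<Longrightarrow> 0 < L i i" "\<And>i j. i < j \<Longrightarrow> L i j = 0"
    "\<And>i j. i < k \<Longrightarrow> j < k \<Longrightarrow> S i j = (\<Sum>l<k. L l i * L l j)" by blast
  \<comment> \<open>\<open>M\<close> is \<open>S\<close> plus a rank-one matrix built from the last
    row of \<open>M\<close>. That row, scaled by \<open>1 / sqrt a\<close>, becomes the last row of
    the factor; the old rows already vanish in column \<open>k\<close>.\<close>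
  define L' where "L' = (\<lambda>i j. if i < k then L i j else if j \<le> k \<and> i = k then M k j / sqrt a else 0)"
  have sa: "sqrt a * sqrt a = a" "sqrt a > 0" using a by auto
  have "M i j = (\<Sum>l<Suc k. L' l i * L' l j)" if "i < Suc k" "j < Suc k" for i j
  proof (cases "i < k \<and> j < k")
    case True
    then have "(\<Sum>l<Suc k. L' l i * L' l j) = S i j + M k i * M k j / a"
      using L(3)[of i j] sa by (simp add: L'_def)
    then show ?thesis using True sym[of i k] by (simp add: S_def)
  next
    case False
    then have "(\<Sum>l<k. L' l i * L' l j) = 0"
      using that L(2) by (intro sum.neutral) (auto simp: L'_def less_Suc_eq)
    then have "(\<Sum>l<Suc k. L' l i * L' l j) = M k i * M k j / a"
      using that sa by (simp add: L'_def)
    then show ?thesis using False that a sym[of i k] by (auto simp: less_Suc_eq a_def)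
  qed
  moreover have "\<forall>i<Suc k. 0 < L' i i" using L a sa by (auto simp: L'_def less_Suc_eq a_def)
  moreover have "\<forall>i j. i < j \<longrightarrow> L' i j = 0" using L(2) by (auto simp: L'_def)
  ultimately show ?case by blast
qed

section \<open>Gaussian integrals in triangular coordinates\<close>

lemma nn_integral_gaussian:
  fixes a s :: real
  assumes "0 < a"
  shows "(\<integral>\<^sup>+ y. ennreal (exp (- pi * (a * y + s)\<^sup>2)) \<partial>lborel) = ennreal (1 / a)"
proof -
  \<comment> \<open>Up to the factor \<open>1 / a\<close> the integrand is the normal density with
    mean \<open>- s / a\<close> and this deviation; the \<open>pi\<close> in the exponent leaves no
    other constant.\<close>
  define \<sigma> where "\<sigma> = 1 / (a * sqrt (2 * pi))"
  have s: "0 < \<sigma>" using assms by (simp add: \<sigma>_def)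
  have s2: "\<sigma>\<^sup>2 = 1 / (a\<^sup>2 * (2 * pi))" by (simp add: \<sigma>_def power_divide power_mult_distrib)
  have e: "exp (- pi * (a * y + s)\<^sup>2) = normal_density (- s / a) \<sigma> y / a" for y
  proof -
    have "sqrt (2 * pi * \<sigma>\<^sup>2) = 1 / a" using assms by (simp add: s2 real_sqrt_divide)
    moreover have "- (y - - s / a)\<^sup>2 / (2 * \<sigma>\<^sup>2) = - pi * (a * y + s)\<^sup>2"
      using assms unfolding s2 by (simp add: field_simps power2_eq_square)
    ultimately show ?thesis using assms by (simp add: normal_density_def)
  qed
  interpret prob_space "density lborel (normal_density (- s / a) \<sigma>)"
    using s by (rule prob_space_normal_density)
  have 1: "(\<integral>\<^sup>+ y. ennreal (normal_density (- s / a) \<sigma> y) \<partial>lborel) = 1"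
    using emeasure_space_1 by (simp add: emeasure_density)
  have "(\<integral>\<^sup>+ y. ennreal (exp (- pi * (a * y + s)\<^sup>2)) \<partial>lborel)
      = (\<integral>\<^sup>+ y. ennreal (1 / a) * ennreal (normal_density (- s / a) \<sigma> y) \<partial>lborel)"
    unfolding e using assms by (intro nn_integral_cong) (simp add: ennreal_mult'[symmetric])
  also have "\<dots> = ennreal (1 / a)"
    by (subst nn_integral_cmult) (simp, simp only: 1 mult_1_right)
  finally show ?thesis .
qed

text \<open>Integrate the last variable first: only the last square contains it, and the other
  variables merely shift that one-dimensional Gaussian, whose integral \<open>1 / L k k\<close> does
  not depend on the shift.\<close>

lemma nn_integral_gaussian_triangular:
  fixes L :: "nat \<Rightarrow> nat \<Rightarrow> real"
  assumes "\<And>i. i < k \<Longrightarrow> 0 < L i i"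
  shows "(\<integral>\<^sup>+ x. ennreal (exp (- pi * (\<Sum>i<k. (\<Sum>j<Suc i. L i j * x j)\<^sup>2))) \<partial>(\<Pi>\<^sub>M i\<in>{..<k}. lborel))
    = ennreal (1 / (\<Prod>i<k. L i i))"
  using assms
proof (induction k)
  case 0
  interpret product_sigma_finite "\<lambda>i. lborel :: real measure" by unfold_locales
  show ?case by (simp only: lessThan_0 nn_integral_empty zero_le) simp
next
  case (Suc k)
  interpret product_sigma_finite "\<lambda>i. lborel :: real measure" by unfold_locales
  let ?f = "\<lambda>k x. ennreal (exp (- pi * (\<Sum>i<k. (\<Sum>j<Suc i. L i j * x j)\<^sup>2)))"
  have meas: "?f k \<in> borel_measurable (\<Pi>\<^sub>M i\<in>{..<k}. lborel)" for k
  proof -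
    have "(\<lambda>x. \<Sum>j<Suc i. L i j * x j) \<in> borel_measurable (\<Pi>\<^sub>M i\<in>{..<k}. lborel)" if "i < k" for i
    proof (intro borel_measurable_sum borel_measurable_times borel_measurable_const)
      fix j assume "j \<in> {..<Suc i}"
      with that have "j \<in> {..<k}" by auto
      then show "(\<lambda>x. x j) \<in> borel_measurable (\<Pi>\<^sub>M i\<in>{..<k}. lborel)"
        using measurable_component_singleton[of j "{..<k}" "\<lambda>_. lborel"] by simp
    qed
    then have "(\<lambda>x. \<Sum>i<k. (\<Sum>j<Suc i. L i j * x j)\<^sup>2) \<in> borel_measurable (\<Pi>\<^sub>M i\<in>{..<k}. lborel)"
      by (intro borel_measurable_sum borel_measurable_power) auto
    then show ?thesis by measurable
  qed
  have step: "(\<integral>\<^sup>+ y. ?f (Suc k) (x(k := y)) \<partial>lborel) = ennreal (1 / L k k) * ?f k x" for x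
  proof -
    define s where "s = (\<Sum>j<k. L k j * x j)"
    have "(\<integral>\<^sup>+ y. ?f (Suc k) (x(k := y)) \<partial>lborel)
       = (\<integral>\<^sup>+ y. ?f k x * ennreal (exp (- pi * (L k k * y + s)\<^sup>2)) \<partial>lborel)"
    proof (intro nn_integral_cong)
      fix y
      have "(\<Sum>i<k. (\<Sum>j<Suc i. L i j * (x(k := y)) j)\<^sup>2) = (\<Sum>i<k. (\<Sum>j<Suc i. L i j * x j)\<^sup>2)"
        by (intro sum.cong refl arg_cong[where f = "\<lambda>z. z\<^sup>2"]) auto
      moreover have "(\<Sum>j<Suc k. L k j * (x(k := y)) j) = L k k * y + s"
        by (simp add: s_def)
      ultimately show "?f (Suc k) (x(k := y)) = ?f k x * ennreal (exp (- pi * (L k k * y + s)\<^sup>2))"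
        by (simp only: sum.lessThan_Suc[of _ k] distrib_left exp_add ennreal_mult' exp_ge_zero)
    qed
    also have "\<dots> = ?f k x * ennreal (1 / L k k)"
      using Suc.prems[of k] by (subst nn_integral_cmult) (simp_all only: nn_integral_gaussian lessI, simp)
    finally show ?thesis by (simp only: mult.commute)
  qed
  have "(\<integral>\<^sup>+ x. ?f (Suc k) x \<partial>(\<Pi>\<^sub>M i\<in>insert k {..<k}. lborel))
    = (\<integral>\<^sup>+ x. (\<integral>\<^sup>+ y. ?f (Suc k) (x(k := y)) \<partial>lborel) \<partial>(\<Pi>\<^sub>M i\<in>{..<k}. lborel))"
    using meas[of "Suc k"] by (intro product_nn_integral_insert) (auto simp: lessThan_Suc)
  also have "\<dots> = ennreal (1 / L k k) * (\<integral>\<^sup>+ x. ?f k x \<partial>(\<Pi>\<^sub>M i\<in>{..<k}. lborel))"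
    unfolding step using meas[of k] by (rule nn_integral_cmult)
  also have "\<dots> = ennreal (1 / L k k) * ennreal (1 / (\<Prod>i<k. L i i))"
    using Suc by simp
  also have "\<dots> = ennreal (1 / (\<Prod>i<Suc k. L i i))"
    using Suc.prems by (subst ennreal_mult'[symmetric]) (auto intro!: prod_nonneg less_imp_le simp: mult.commute)
  finally show ?case by (simp only: lessThan_Suc)
qed

section \<open>Positive definite matrices and their Cholesky factors\<close>

definition pos_def :: "nat \<Rightarrow> real mat \<Rightarrow> bool" where
  "pos_def k M \<longleftrightarrow> M \<in> carrier_mat k k \<and> transpose_mat M = M \<and>
     (\<forall>x\<in>carrier_vec k. x \<noteq> 0\<^sub>v k \<longrightarrow> 0 < scalar_prod x (M *\<^sub>v x))"

lemma scalar_prod_mult_mat_vec: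
  fixes M :: "real mat"
  assumes "M \<in> carrier_mat k k" "x \<in> carrier_vec k"
  shows "scalar_prod x (M *\<^sub>v x) = (\<Sum>i<k. \<Sum>j<k. M $$ (i, j) * x $ i * x $ j)"
  using assms
  by (auto simp: scalar_prod_def mult_mat_vec_def sum_distrib_left lessThan_atLeast0 ac_simps intro!: sum.cong)

lemma scalar_prod_self_nonneg: "0 \<le> scalar_prod x (x :: real vec)"
  by (auto simp: scalar_prod_def intro!: sum_nonneg)

lemma scalar_prod_self_eq_0:
  fixes x :: "real vec"
  assumes "x \<in> carrier_vec k" "scalar_prod x x = 0"
  shows "x = 0\<^sub>v k"
  using assms by (auto simp: scalar_prod_def sum_nonneg_eq_0_iff intro!: eq_vecI)

lemma scalar_prod_transpose_mult:
  fixes A :: "real mat"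
  assumes "A \<in> carrier_mat r k" "x \<in> carrier_vec k"
  shows "scalar_prod x ((transpose_mat A * A) *\<^sub>v x) = scalar_prod (A *\<^sub>v x) (A *\<^sub>v x)"
proof -
  have Ax: "A *\<^sub>v x \<in> carrier_vec r" using assms by simp
  have "scalar_prod x ((transpose_mat A * A) *\<^sub>v x) = scalar_prod (transpose_mat A *\<^sub>v (A *\<^sub>v x)) x"
    using assms Ax comm_scalar_prod[of x k "transpose_mat A *\<^sub>v (A *\<^sub>v x)"]
    by (subst assoc_mult_mat_vec[of _ k r _ k]) auto
  also have "\<dots> = scalar_prod (A *\<^sub>v x) (A *\<^sub>v x)"
    by (rule transpose_vec_mult_scalar[OF assms Ax])
  finally show ?thesis .
qed

lemma pos_def_transpose_mult:
  fixes A :: "real mat"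
  assumes A: "A \<in> carrier_mat r k"
    and inj: "\<And>x. x \<in> carrier_vec k \<Longrightarrow> A *\<^sub>v x = 0\<^sub>v r \<Longrightarrow> x = 0\<^sub>v k"
  shows "pos_def k (transpose_mat A * A)"
  unfolding pos_def_def
proof (intro conjI ballI impI)
  show "transpose_mat A * A \<in> carrier_mat k k" using A by simp
  show "transpose_mat (transpose_mat A * A) = transpose_mat A * A"
    using A by (subst transpose_mult[of _ k r _ k]) auto
  fix x :: "real vec" assume x: "x \<in> carrier_vec k" "x \<noteq> 0\<^sub>v k"
  have "scalar_prod (A *\<^sub>v x) (A *\<^sub>v x) \<noteq> 0"
    using scalar_prod_self_eq_0[of "A *\<^sub>v x" r] A x inj[of x] by auto
  then show "0 < scalar_prod x ((transpose_mat A * A) *\<^sub>v x)"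
    using scalar_prod_self_nonneg[of "A *\<^sub>v x"] scalar_prod_transpose_mult[OF A x(1)] by simp
qed

lemma det_lower_triangular_prod:
  fixes L :: "real mat"
  assumes "L \<in> carrier_mat k k" "\<And>i j. i < j \<Longrightarrow> j < k \<Longrightarrow> L $$ (i, j) = 0"
  shows "det L = (\<Prod>i<k. L $$ (i, i))"
  using det_lower_triangular[OF assms(2,1)] assms(1)
  by (simp add: prod_list_diag_prod lessThan_atLeast0)

text \<open>Matrix form of \<open>cholesky_entries\<close>, with the determinants included: the
  trace, determinant and integral estimates are all read off from the triangular factor.\<close>

lemma cholesky:
  assumes "pos_def k M"
  obtains L where "L \<in> carrier_mat k k" "\<And>i j. i < j \<Longrightarrow> j < k \<Longrightarrow> L $$ (i, j) = 0"
    "\<And>i. i < k \<Longrightarrow> 0 < L $$ (i, i)" "M = transpose_mat L * L" "det L = (\<Prod>i<k. L $$ (i, i))"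
    "0 < det L" "det M = (det L)\<^sup>2"
proof -
  have M: "M \<in> carrier_mat k k" and sym: "transpose_mat M = M"
    and pos: "\<And>x. x \<in> carrier_vec k \<Longrightarrow> x \<noteq> 0\<^sub>v k \<Longrightarrow> 0 < scalar_prod x (M *\<^sub>v x)"
    using assms by (auto simp: pos_def_def)
  have "\<exists>L. (\<forall>i<k. 0 < L i i) \<and> (\<forall>i j. i < j \<longrightarrow> L i j = 0) \<and>
             (\<forall>i<k. \<forall>j<k. M $$ (i, j) = (\<Sum>l<k. L l i * L l j))"
  proof (rule cholesky_entries)
    fix i j assume "i < k" "j < k"
    then show "M $$ (i, j) = M $$ (j, i)"
      using M arg_cong[OF sym, of "\<lambda>A. A $$ (i, j)"] by simp
  next
    fix x :: "nat \<Rightarrow> real" assume "\<exists>i<k. x i \<noteq> 0"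
    then have "Matrix.vec k x \<noteq> 0\<^sub>v k" by (auto simp: vec_eq_iff)
    from pos[OF _ this] show "0 < (\<Sum>i<k. \<Sum>j<k. M $$ (i, j) * x i * x j)"
      using M by (simp add: scalar_prod_mult_mat_vec)
  qed
  then obtain L where L: "\<And>i. i < k \<Longrightarrow> 0 < L i i" "\<And>i j. i < j \<Longrightarrow> L i j = 0"
    "\<And>i j. i < k \<Longrightarrow> j < k \<Longrightarrow> M $$ (i, j) = (\<Sum>l<k. L l i * L l j)" by blast
  define L' where "L' = Matrix.mat k k (\<lambda>(i, j). L i j)"
  have L': "L' \<in> carrier_mat k k" by (simp add: L'_def)
  have Meq: "M = transpose_mat L' * L'"
    using M L(3) by (intro eq_matI) (auto simp: L'_def scalar_prod_def lessThan_atLeast0)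
  have low: "L' $$ (i, j) = 0" if "i < j" "j < k" for i j using that L(2) by (simp add: L'_def)
  have diag: "0 < L' $$ (i, i)" if "i < k" for i using that L(1) by (simp add: L'_def)
  have det: "det L' = (\<Prod>i<k. L' $$ (i, i))" using det_lower_triangular_prod[OF L' low] .
  moreover have "0 < det L'" unfolding det using diag by (intro prod_pos) auto
  moreover have "det M = (det L')\<^sup>2"
    unfolding Meq using L' by (simp add: det_mult[of _ k] det_transpose power2_eq_square)
  ultimately show thesis using that[OF L' low diag Meq] by blast
qed

lemma pos_def_det_pos:
  assumes "pos_def k M"
  shows "0 < det M"
proof -
  from assms obtain L where "0 < det L" "det M = (det L)\<^sup>2" by (rule cholesky)
  then show ?thesis by simp
qed

lemma obtain_inverse_mat:
  fixes A :: "real mat"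
  assumes "A \<in> carrier_mat k k" "det A \<noteq> 0"
  obtains A' where "A' \<in> carrier_mat k k" "A * A' = 1\<^sub>m k" "A' * A = 1\<^sub>m k"
  using det_non_zero_imp_unit[OF assms, of "()"] by (auto simp: Units_def ring_mat_def)

lemma invertible_mat_if_det:
  fixes A :: "real mat"
  assumes "A \<in> carrier_mat k k" "det A \<noteq> 0"
  shows "invertible_mat A"
  by (rule obtain_inverse_mat[OF assms])
    (use assms in \<open>auto simp: invertible_mat_def inverts_mat_def intro!: exI\<close>)

text \<open>\<open>A\<close> may be rectangular: besides square invertible matrices, the application
  is to \<open>transpose_mat (Z j)\<close> in \<open>sinkhorn_step\<close>, for which a left inverse
  is exhibited.\<close>

lemma mult_mat_vec_eq_0:
  fixes A :: "real mat"
  assumes "A \<in> carrier_mat r k" "A' \<in> carrier_mat k r" "A' * A = 1\<^sub>m k" "x \<in> carrier_vec k" "A *\<^sub>v x = 0\<^sub>v r"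
  shows "x = 0\<^sub>v k"
proof -
  have "x = (A' * A) *\<^sub>v x" using assms by simp
  also have "\<dots> = A' *\<^sub>v (A *\<^sub>v x)" using assms by (intro assoc_mult_mat_vec) auto
  also have "\<dots> = 0\<^sub>v k" using assms by (auto intro!: eq_vecI)
  finally show ?thesis .
qed

text \<open>\<open>U\<close> is the inverse of the Cholesky factor. It serves twice in a Sinkhorn
  step: for the Gram matrix and for each component.\<close>

lemma pos_def_congruent_one:
  assumes "pos_def k M"
  obtains U where "U \<in> carrier_mat k k" "det U \<noteq> 0" "transpose_mat U * M * U = 1\<^sub>m k" "(det U)\<^sup>2 * det M = 1"
proof -
  from assms obtain L where L: "L \<in> carrier_mat k k" "M = transpose_mat L * L" "0 < det L" "det M = (det L)\<^sup>2"
    by (elim cholesky) auto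
  obtain U where U: "U \<in> carrier_mat k k" "L * U = 1\<^sub>m k" "U * L = 1\<^sub>m k"
    using obtain_inverse_mat[OF L(1)] L(3) by auto
  have "transpose_mat U * M * U = transpose_mat U * transpose_mat L * (L * U)"
    unfolding L(2) using L(1) U(1) by (simp add: assoc_mult_mat[of _ k k _ k _ k])
  also have "transpose_mat U * transpose_mat L = transpose_mat (L * U)"
    using transpose_mult[OF L(1) U(1)] by simp
  finally have 1: "transpose_mat U * M * U = 1\<^sub>m k" by (simp add: U)
  have "det L * det U = 1" using det_mult[OF L(1) U(1)] U(2) by simp
  then have "(det U)\<^sup>2 * det M = 1" unfolding L(4) by (metis mult.commute power_mult_distrib power_one)
  moreover from this have "det U \<noteq> 0" by auto
  ultimately show thesis using that U(1) 1 by blast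
qed

section \<open>Trace against determinant\<close>

lemma sum_diag_transpose_mult:
  fixes A :: "real mat"
  assumes "A \<in> carrier_mat r k"
  shows "(\<Sum>i<k. (transpose_mat A * A) $$ (i, i)) = (\<Sum>i<r. \<Sum>j<k. (A $$ (i, j))\<^sup>2)"
  using assms
  by (subst sum.swap) (simp add: scalar_prod_def lessThan_atLeast0 power2_eq_square)

lemma sum_squares_split_diagonal:
  fixes L :: "real mat"
  assumes "L \<in> carrier_mat k k"
  shows "(\<Sum>i<k. \<Sum>j<k. (L $$ (i, j))\<^sup>2) = (\<Sum>i<k. (L $$ (i, i))\<^sup>2) + (\<Sum>i<k. \<Sum>j\<in>{..<k} - {i}. (L $$ (i, j))\<^sup>2)"
  by (simp add: sum.distrib[symmetric] sum.remove[of "{..<k}"])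

text \<open>In terms of the Cholesky factor the determinant is the product of the squared diagonal
  entries and the trace is at least their sum; \<open>x \<le> exp (x - 1)\<close> for each factor
  does the rest.\<close>

lemma det_le_exp_trace:
  assumes "pos_def k M"
  shows "det M \<le> exp ((\<Sum>i<k. M $$ (i, i)) - real k)"
proof -
  from assms obtain L where L: "L \<in> carrier_mat k k" "M = transpose_mat L * L"
    "det L = (\<Prod>i<k. L $$ (i, i))" "det M = (det L)\<^sup>2"
    by (elim cholesky) auto
  have "det M = (\<Prod>i<k. (L $$ (i, i))\<^sup>2)"
    using L by (simp add: prod_power_distrib)
  also have "\<dots> \<le> (\<Prod>i<k. exp ((L $$ (i, i))\<^sup>2 - 1))"
    using exp_ge_add_one_self[of "(L $$ (i, i))\<^sup>2 - 1" for i] by (intro prod_mono) auto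
  also have "\<dots> = exp ((\<Sum>i<k. (L $$ (i, i))\<^sup>2) - real k)"
    by (simp add: exp_sum[symmetric] sum_subtractf)
  also have "\<dots> \<le> exp ((\<Sum>i<k. M $$ (i, i)) - real k)"
    unfolding L(2) sum_diag_transpose_mult[OF L(1)] sum_squares_split_diagonal[OF L(1)] by (simp add: sum_nonneg)
  finally show ?thesis .
qed

text \<open>Equality case of \<open>det_le_exp_trace\<close>: no loss is left in any of the
  inequalities used there, so the Cholesky factor itself is the identity.\<close>

lemma pos_def_eq_one:
  assumes "pos_def k M" and tr: "(\<Sum>i<k. M $$ (i, i)) = real k" and det: "1 \<le> det M"
  shows "M = 1\<^sub>m k"
proof -
  from assms(1) obtain L where L: "L \<in> carrier_mat k k" "M = transpose_mat L * L"
    "\<And>i. i < k \<Longrightarrow> 0 < L $$ (i, i)" "det L = (\<Prod>i<k. L $$ (i, i))" "det M = (det L)\<^sup>2"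
    by (elim cholesky) auto
  \<comment> \<open>\<open>D i\<close> is the slack in \<open>ln x \<le> x - 1\<close> at the
    squared diagonal entry, \<open>O' i\<close> the squared off-diagonal mass of row
    \<open>i\<close>. The terms are nonnegative, and their total is
    \<open>tr M - k - ln (det M)\<close>, which is at most 0 here.\<close>
  define D O' where "D = (\<lambda>i. (L $$ (i, i))\<^sup>2 - 1 - ln ((L $$ (i, i))\<^sup>2))"
    and "O' = (\<lambda>i. \<Sum>j\<in>{..<k} - {i}. (L $$ (i, j))\<^sup>2)"
  have D: "0 \<le> D i" if "i < k" for i
    using ln_le_minus_one[of "(L $$ (i, i))\<^sup>2"] L(3)[OF that] by (simp add: D_def)
  have O: "0 \<le> O' i" for i by (auto simp: O'_def intro: sum_nonneg)
  have "ln (det M) = (\<Sum>i<k. ln ((L $$ (i, i))\<^sup>2))"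
    using L(3,4,5) by (subst ln_prod[symmetric]) (auto simp: prod_power_distrib less_imp_neq[symmetric])
  moreover have "(\<Sum>i<k. (L $$ (i, i))\<^sup>2) + (\<Sum>i<k. O' i) = real k"
    using tr sum_squares_split_diagonal[OF L(1)] by (simp add: L(2) sum_diag_transpose_mult[OF L(1)] O'_def)
  moreover have "0 \<le> ln (det M)" using det by simp
  ultimately have "(\<Sum>i<k. D i + O' i) \<le> 0" by (simp add: D_def sum.distrib sum_subtractf)
  then have "(\<Sum>i<k. D i + O' i) = 0" using D O by (intro antisym sum_nonneg) auto
  then have "\<forall>i\<in>{..<k}. D i + O' i = 0" using D O by (subst (asm) sum_nonneg_eq_0_iff) auto
  then have z: "D i = 0" "O' i = 0" if "i < k" for i
    using that D[of i] O[of i] by (auto dest!: bspec[of _ _ i])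
  have diag: "L $$ (i, i) = 1" if i: "i < k" for i
  proof -
    have "(L $$ (i, i))\<^sup>2 = 1"
      using z(1)[OF i] L(3)[OF i] ln_eq_minus_one[of "(L $$ (i, i))\<^sup>2"] by (simp add: D_def)
    then show ?thesis using L(3)[OF i] by (simp add: power2_eq_1_iff)
  qed
  have off: "L $$ (i, j) = 0" if "i < k" "j < k" "i \<noteq> j" for i j
    using z(2)[OF that(1)] that by (auto simp: O'_def sum_nonneg_eq_0_iff)
  have "L = 1\<^sub>m k" using L(1) diag off by (intro eq_matI) auto
  then show ?thesis using L(2) by simp
qed

section \<open>Gaussian integrals over \<open>carrier_vec\<close>\<close>

lemma inj_on_vec: "inj_on (Matrix.vec k) (space (\<Pi>\<^sub>M i\<in>{..<k}. lborel :: real measure))"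
proof (rule inj_onI)
  fix x y :: "nat \<Rightarrow> real"
  assume xy: "x \<in> space (\<Pi>\<^sub>M i\<in>{..<k}. lborel)" "y \<in> space (\<Pi>\<^sub>M i\<in>{..<k}. lborel)"
    and e: "Matrix.vec k x = Matrix.vec k y"
  \<comment> \<open>The points of the product space are extensional, so their values below
    \<open>k\<close> determine them.\<close>
  from xy have "x \<in> extensional {..<k}" "y \<in> extensional {..<k}"
    by (simp_all add: space_PiM PiE_def)
  moreover have "x i = y i" if "i < k" for i
    using arg_cong[OF e, of "\<lambda>v. v $ i"] that by simp
  ultimately show "x = y" by (auto intro: extensionalityI)
qed

lemma borel_measurable_quadratic_form:
  fixes M :: "real mat"
  assumes "M \<in> carrier_mat k k"
  shows "(\<lambda>x. scalar_prod x (M *\<^sub>v x)) \<in> borel_measurable (lborel_vec k)"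
  unfolding lborel_vec_def
proof (rule measurable_embed_measure1)
  show "(\<lambda>x. scalar_prod (Matrix.vec k x) (M *\<^sub>v Matrix.vec k x)) \<in> borel_measurable (\<Pi>\<^sub>M i\<in>{..<k}. lborel)"
    using assms
    by (simp add: scalar_prod_mult_mat_vec)
qed

text \<open>No change of variables is needed: written through \<open>L\<close>, the form is a sum of
  squares of triangular linear forms in the original coordinates.\<close>

lemma nn_integral_gaussian_vec:
  assumes "pos_def k M"
  shows "(\<integral>\<^sup>+ x. ennreal (exp (- pi * scalar_prod x (M *\<^sub>v x))) \<partial>lborel_vec k) = ennreal (1 / sqrt (det M))"
proof -
  from assms obtain L where L: "L \<in> carrier_mat k k" "\<And>i j. i < j \<Longrightarrow> j < k \<Longrightarrow> L $$ (i, j) = 0"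
    "\<And>i. i < k \<Longrightarrow> 0 < L $$ (i, i)" "M = transpose_mat L * L" "det L = (\<Prod>i<k. L $$ (i, i))"
    "0 < det L" "det M = (det L)\<^sup>2"
    by (elim cholesky) auto
  have M: "M \<in> carrier_mat k k" using assms by (simp add: pos_def_def)
  have *: "scalar_prod (Matrix.vec k x) (M *\<^sub>v Matrix.vec k x) = (\<Sum>i<k. (\<Sum>j<Suc i. L $$ (i, j) * x j)\<^sup>2)" for x
  proof -
    have "(\<Sum>j<k. L $$ (i, j) * x j) = (\<Sum>j<Suc i. L $$ (i, j) * x j)" if "i < k" for i
      using that L(2) by (intro sum.mono_neutral_right) (auto simp: not_less)
    then have "scalar_prod (L *\<^sub>v Matrix.vec k x) (L *\<^sub>v Matrix.vec k x) = (\<Sum>i<k. (\<Sum>j<Suc i. L $$ (i, j) * x j)\<^sup>2)"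
      using L(1) by (simp del: sum.lessThan_Suc add: scalar_prod_def lessThan_atLeast0[symmetric] power2_eq_square)
    then show ?thesis
      using L(1) unfolding L(4) by (simp only: scalar_prod_transpose_mult[OF L(1)] vec_carrier)
  qed
  have meas: "(\<lambda>x. ennreal (exp (- pi * scalar_prod x (M *\<^sub>v x)))) \<in> borel_measurable (lborel_vec k)"
    using borel_measurable_quadratic_form[OF M] by measurable
  have "(\<integral>\<^sup>+ x. ennreal (exp (- pi * scalar_prod x (M *\<^sub>v x))) \<partial>lborel_vec k)
     = (\<integral>\<^sup>+ x. ennreal (exp (- pi * (\<Sum>i<k. (\<Sum>j<Suc i. L $$ (i, j) * x j)\<^sup>2))) \<partial>(\<Pi>\<^sub>M i\<in>{..<k}. lborel))"
    using nn_integral_embed_measure'[OF inj_on_vec meas[unfolded lborel_vec_def]]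
    unfolding lborel_vec_def by (simp only: *)
  also have "\<dots> = ennreal (1 / det L)"
    using L(3,5) by (subst nn_integral_gaussian_triangular) auto
  also have "det L = sqrt (det M)" using L by simp
  finally show ?thesis .
qed

section \<open>Gaussian test functions\<close>

text \<open>The matrix that \<open>BL_geometric\<close> requires to be the identity, in the same
  entrywise form. For coisometric components, being geometric thus means
  \<open>gram n m c X = 1\<^sub>m n\<close>.\<close>

definition gram :: "nat \<Rightarrow> nat \<Rightarrow> (nat \<Rightarrow> real) \<Rightarrow> (nat \<Rightarrow> real mat) \<Rightarrow> real mat" where
  "gram n m c X =
     Matrix.mat n n (\<lambda>(i, k). \<Sum>j<m. (c j \<cdot>\<^sub>m (transpose_mat (X j) * X j)) $$ (i, k))"

lemma gram_carrier [simp]: "gram n m c X \<in> carrier_mat n n"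
  by (simp add: gram_def)

lemma gram_cong: "(\<And>j. j < m \<Longrightarrow> X j = Y j) \<Longrightarrow> gram n m c X = gram n m c Y"
  by (auto simp: gram_def intro!: eq_matI sum.cong)

lemma gram_0 [simp]: "gram n 0 c X = 0\<^sub>m n n"
  by (auto simp: gram_def intro!: eq_matI)

lemma gram_Suc:
  assumes "X m \<in> carrier_mat r n"
  shows "gram n (Suc m) c X = gram n m c X + c m \<cdot>\<^sub>m (transpose_mat (X m) * X m)"
  using assms by (intro eq_matI) (auto simp: gram_def)

lemma gram_index:
  assumes "\<And>j. j < m \<Longrightarrow> X j \<in> carrier_mat (d j) n" "i < n" "k < n"
  shows "gram n m c X $$ (i, k) = (\<Sum>j<m. c j * (\<Sum>l<d j. X j $$ (l, i) * X j $$ (l, k)))"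
  using assms(2,3) unfolding gram_def
  by simp (intro sum.cong refl, insert assms, force simp: scalar_prod_def lessThan_atLeast0)

lemma gram_sym:
  assumes "\<And>j. j < m \<Longrightarrow> X j \<in> carrier_mat (d j) n"
  shows "transpose_mat (gram n m c X) = gram n m c X"
proof (rule eq_matI)
  fix i k assume "i < dim_row (gram n m c X)" "k < dim_col (gram n m c X)"
  then have "i < n" "k < n" by (auto simp: gram_def)
  then show "transpose_mat (gram n m c X) $$ (i, k) = gram n m c X $$ (i, k)"
    using carrier_matD[OF gram_carrier[of n m c X]]
    by (simp add: gram_index[OF assms] mult.commute)
qed (use carrier_matD[OF gram_carrier[of n m c X]] in auto)

lemma gram_mult_right:
  assumes "\<And>j. j < m \<Longrightarrow> X j \<in> carrier_mat (d j) n" "T \<in> carrier_mat n k"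
  shows "gram k m c (\<lambda>j. X j * T) = transpose_mat T * gram n m c X * T"
  using assms(1)
proof (induction m)
  case 0
  then show ?case using assms(2) by simp
next
  case (Suc m)
  note T = assms(2)
  have X: "X m \<in> carrier_mat (d m) n" using Suc.prems by simp
  have G: "gram n m c X \<in> carrier_mat n n" by simp
  have "transpose_mat (X m * T) * (X m * T) = transpose_mat T * (transpose_mat (X m) * X m) * T"
    using X T by (simp add: transpose_mult assoc_mult_mat[of _ k n _ n _ k] assoc_mult_mat[of _ k n _ "d m" _ k]
        assoc_mult_mat[of _ n "d m" _ n _ k])
  then have "c m \<cdot>\<^sub>m (transpose_mat (X m * T) * (X m * T)) = transpose_mat T * (c m \<cdot>\<^sub>m (transpose_mat (X m) * X m)) * T"
    using X T by (simp add: mult_smult_distrib[of _ k n _ n] mult_smult_assoc_mat[of _ k n _ k])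
  moreover have "transpose_mat T * (gram n m c X + c m \<cdot>\<^sub>m (transpose_mat (X m) * X m)) * T
     = transpose_mat T * gram n m c X * T + transpose_mat T * (c m \<cdot>\<^sub>m (transpose_mat (X m) * X m)) * T"
    using X T G by (simp add: mult_add_distrib_mat[of _ k n _ n] add_mult_distrib_mat[of _ k n _ _ k])
  moreover have "X m * T \<in> carrier_mat (d m) k" using X T by simp
  ultimately show ?case
    using Suc by (simp add: gram_Suc[of X m "d m"] gram_Suc[of "\<lambda>j. X j * T" m "d m"])
qed

lemma smult_mat_mult_vec:
  fixes A :: "real mat"
  assumes "A \<in> carrier_mat r k" "x \<in> carrier_vec k"
  shows "(a \<cdot>\<^sub>m A) *\<^sub>v x = a \<cdot>\<^sub>v (A *\<^sub>v x)"
  using assms by (intro eq_vecI) (auto simp: row_smult)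

lemma gram_Suc_mult_vec:
  assumes "X m \<in> carrier_mat r n" "x \<in> carrier_vec n"
  shows "gram n (Suc m) c X *\<^sub>v x = gram n m c X *\<^sub>v x + c m \<cdot>\<^sub>v (transpose_mat (X m) *\<^sub>v (X m *\<^sub>v x))"
proof -
  have "gram n (Suc m) c X *\<^sub>v x = gram n m c X *\<^sub>v x + (c m \<cdot>\<^sub>m (transpose_mat (X m) * X m)) *\<^sub>v x"
    unfolding gram_Suc[of X m r, OF assms(1)] using assms by (intro add_mult_distrib_mat_vec[of _ n n]) auto
  also have "(c m \<cdot>\<^sub>m (transpose_mat (X m) * X m)) *\<^sub>v x = c m \<cdot>\<^sub>v ((transpose_mat (X m) * X m) *\<^sub>v x)"
    using assms by (intro smult_mat_mult_vec[of _ n n]) auto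
  also have "(transpose_mat (X m) * X m) *\<^sub>v x = transpose_mat (X m) *\<^sub>v (X m *\<^sub>v x)"
    using assms by (intro assoc_mult_mat_vec) auto
  finally show ?thesis .
qed

text \<open>This turns a product of Gaussians composed with the components into one Gaussian whose
  form is the Gram matrix.\<close>

lemma gram_quadratic_form:
  assumes "\<And>j. j < m \<Longrightarrow> X j \<in> carrier_mat (d j) n" "x \<in> carrier_vec n"
  shows "scalar_prod x (gram n m c X *\<^sub>v x) = (\<Sum>j<m. c j * scalar_prod (X j *\<^sub>v x) (X j *\<^sub>v x))"
  using assms(1)
proof (induction m)
  case 0
  have "0\<^sub>m n n *\<^sub>v x = 0\<^sub>v n" using assms(2) by (auto intro!: eq_vecI)
  then show ?case using assms(2) by simp
next
  case (Suc m)
  have X: "X m \<in> carrier_mat (d m) n" using Suc.prems by simp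
  have Xx: "transpose_mat (X m) *\<^sub>v (X m *\<^sub>v x) \<in> carrier_vec n" "X m *\<^sub>v x \<in> carrier_vec (d m)"
    using X assms(2) by auto
  have "scalar_prod x (transpose_mat (X m) *\<^sub>v (X m *\<^sub>v x)) = scalar_prod (X m *\<^sub>v x) (X m *\<^sub>v x)"
    using transpose_vec_mult_scalar[OF X assms(2) Xx(2)] comm_scalar_prod[OF assms(2) Xx(1)] by simp
  then have "scalar_prod x (gram n (Suc m) c X *\<^sub>v x)
     = scalar_prod x (gram n m c X *\<^sub>v x) + c m * scalar_prod (X m *\<^sub>v x) (X m *\<^sub>v x)"
    unfolding gram_Suc_mult_vec[of X m "d m" n x, OF X assms(2)]
    using Xx assms(2) mult_mat_vec_carrier[OF gram_carrier assms(2), of m c X]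
    by (subst scalar_prod_add_distrib[of _ n]) auto
  then show ?case using Suc by simp
qed

text \<open>Cyclicity of the trace: for each component both traces are the sum of the squares of all
  entries.\<close>

lemma gram_trace:
  assumes "\<And>j. j < m \<Longrightarrow> X j \<in> carrier_mat (d j) n"
  shows "(\<Sum>i<n. gram n m c X $$ (i, i)) = (\<Sum>j<m. c j * (\<Sum>l<d j. (X j * transpose_mat (X j)) $$ (l, l)))"
proof -
  have "(\<Sum>i<n. gram n m c X $$ (i, i)) = (\<Sum>j<m. c j * (\<Sum>i<n. \<Sum>l<d j. (X j $$ (l, i))\<^sup>2))"
    by (simp add: gram_index[OF assms] power2_eq_square sum.swap[of _ "{..<m}"] sum_distrib_left)
  also have "\<dots> = (\<Sum>j<m. c j * (\<Sum>l<d j. (X j * transpose_mat (X j)) $$ (l, l)))"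
  proof (rule sum.cong[OF refl])
    fix j assume "j \<in> {..<m}"
    then have "(\<Sum>i<n. \<Sum>l<d j. (X j $$ (l, i))\<^sup>2) = (\<Sum>l<d j. (X j * transpose_mat (X j)) $$ (l, l))"
      using assms[of j] by (subst sum.swap) (simp add: scalar_prod_def lessThan_atLeast0 power2_eq_square)
    then show "c j * (\<Sum>i<n. \<Sum>l<d j. (X j $$ (l, i))\<^sup>2) = c j * (\<Sum>l<d j. (X j * transpose_mat (X j)) $$ (l, l))"
      by simp
  qed
  finally show ?thesis .
qed

text \<open>The form is a sum of nonnegative terms. If it vanishes at \<open>x\<close>, then every
  \<open>X j\<close> kills \<open>x\<close>, so \<open>x\<close> lies in the kernel of the Gram
  matrix, which is trivial.\<close>

lemma gram_pos_def:
  assumes "\<And>j. j < m \<Longrightarrow> X j \<in> carrier_mat (d j) n" "\<And>j. j < m \<Longrightarrow> 0 < c j" "det (gram n m c X) \<noteq> 0"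
  shows "pos_def n (gram n m c X)"
  unfolding pos_def_def
proof (intro conjI ballI impI)
  show "transpose_mat (gram n m c X) = gram n m c X" using assms(1) by (rule gram_sym)
  fix x :: "real vec" assume x: "x \<in> carrier_vec n" "x \<noteq> 0\<^sub>v n"
  have nonneg: "0 \<le> c j * scalar_prod (X j *\<^sub>v x) (X j *\<^sub>v x)" if "j < m" for j
    using assms(2)[OF that] scalar_prod_self_nonneg by simp
  show "0 < scalar_prod x (gram n m c X *\<^sub>v x)"
  proof (rule ccontr)
    assume "\<not> ?thesis"
    then have "(\<Sum>j<m. c j * scalar_prod (X j *\<^sub>v x) (X j *\<^sub>v x)) = 0"
      using nonneg by (intro antisym sum_nonneg) (auto simp: gram_quadratic_form[OF assms(1) x(1)])
    then have "\<forall>j\<in>{..<m}. c j * scalar_prod (X j *\<^sub>v x) (X j *\<^sub>v x) = 0"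
      using nonneg by (subst (asm) sum_nonneg_eq_0_iff) auto
    then have z: "scalar_prod (X j *\<^sub>v x) (X j *\<^sub>v x) = 0" if "j < m" for j
      using that assms(2)[OF that] by (metis lessThan_iff less_irrefl mult_eq_0_iff)
    have z: "X j *\<^sub>v x = 0\<^sub>v (d j)" if "j < m" for j
      using assms(1)[OF that] x(1) by (intro scalar_prod_self_eq_0 z[OF that]) auto
    have "gram n m c X *\<^sub>v x = 0\<^sub>v n"
      using assms(1) z
    proof (induction m)
      case 0
      show ?case using x(1) by (auto intro!: eq_vecI)
    next
      case (Suc m)
      have X: "X m \<in> carrier_mat (d m) n" using Suc.prems by simp
      have "transpose_mat (X m) *\<^sub>v (X m *\<^sub>v x) = 0\<^sub>v n"
        using Suc.prems(2)[of m] X by (auto intro!: eq_vecI)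
      then show ?case
        using Suc by (simp add: gram_Suc_mult_vec[of X m "d m" n x, OF X x(1)])
          (auto intro!: eq_vecI)
    qed
    then have "det (gram n m c X) = 0"
      using x by (subst det_0_iff_vec_prod_zero[of _ n]) auto
    with assms(3) show False by simp
  qed
qed simp

section \<open>Continuity of the determinant and testing on Gaussians\<close>

lemma tendsto_det:
  fixes A :: "'a \<Rightarrow> real mat"
  assumes "\<And>s. A s \<in> carrier_mat n n" "A' \<in> carrier_mat n n"
    "\<And>i j. i < n \<Longrightarrow> j < n \<Longrightarrow> ((\<lambda>s. A s $$ (i, j)) \<longlongrightarrow> A' $$ (i, j)) F"
  shows "((\<lambda>s. det (A s)) \<longlongrightarrow> det A') F"
proof -
  \<comment> \<open>Permutations keep the indices in range, so every factor of the Leibniz expansion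
    is an entry whose limit is known.\<close>
  have "p i < n" if "p permutes {0..<n}" "i < n" for p i
    using permutes_in_image[OF that(1), of i] that(2) by simp
  then show ?thesis
    unfolding det_def'[OF assms(1)] det_def'[OF assms(2)]
    by (auto intro!: tendsto_intros assms(3))
qed

lemma quadratic_form_add_smult_one:
  fixes A :: "real mat"
  assumes A: "A \<in> carrier_mat n n" and x: "x \<in> carrier_vec n"
  shows "scalar_prod x ((A + e \<cdot>\<^sub>m 1\<^sub>m n) *\<^sub>v x) = scalar_prod x (A *\<^sub>v x) + e * scalar_prod x x"
proof -
  have "(A + e \<cdot>\<^sub>m 1\<^sub>m n) *\<^sub>v x = A *\<^sub>v x + (e \<cdot>\<^sub>m 1\<^sub>m n) *\<^sub>v x"
    using A x by (intro add_mult_distrib_mat_vec[of _ n n]) auto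
  also have "(e \<cdot>\<^sub>m 1\<^sub>m n) *\<^sub>v x = e \<cdot>\<^sub>v x"
    using x by (simp add: smult_mat_mult_vec[of _ n n])
  finally show ?thesis
    using x scalar_prod_add_distrib[OF x mult_mat_vec_carrier[OF A x], of "e \<cdot>\<^sub>v x"] by simp
qed

text \<open>
  Adding \<open>e I\<close> makes the quadratic form definite, whatever the common kernel of the \<open>B\<^sub>j\<close>.
\<close>

lemma BL_const_gaussian:
  assumes B: "\<And>j. j < m \<Longrightarrow> B j \<in> carrier_mat (d j) n"
    and R: "\<And>j. j < m \<Longrightarrow> R j \<in> carrier_mat (d j) (d j)" "\<And>j. j < m \<Longrightarrow> det (R j) \<noteq> 0"
    and c: "\<And>j. j < m \<Longrightarrow> 0 < c j" and e: "0 < e"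
    and K: "BL_const m n d B c \<le> ennreal K" "0 \<le> K"
  shows "(\<Prod>j<m. \<bar>det (R j)\<bar> powr c j) \<le> K * sqrt (det (gram n m c (\<lambda>j. R j * B j) + e \<cdot>\<^sub>m 1\<^sub>m n))"
proof -
  let ?G = "gram n m c (\<lambda>j. R j * B j)"
  \<comment> \<open>\<open>f j\<close> is \<open>exp (- pi * |R j y|^2)\<close>, with integral
    \<open>1 / \<bar>det (R j)\<bar>\<close>; the denominator of the quotient is therefore
    \<open>1 / ?P\<close>.\<close>
  define A where "A = (\<lambda>j. transpose_mat (R j) * R j)"
  define f where "f = (\<lambda>j y. exp (- pi * scalar_prod y (A j *\<^sub>v y)))"
  have RB: "R j * B j \<in> carrier_mat (d j) n" if "j < m" for j using R(1)[OF that] B[OF that] by simp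
  have A: "pos_def (d j) (A j)" if j: "j < m" for j
  proof -
    obtain R' where R': "R' \<in> carrier_mat (d j) (d j)" "R' * R j = 1\<^sub>m (d j)"
      using obtain_inverse_mat[OF R(1)[OF j] R(2)[OF j]] by blast
    show ?thesis
      unfolding A_def by (rule pos_def_transpose_mult[OF R(1)[OF j] mult_mat_vec_eq_0[OF R(1)[OF j] R']])
  qed
  have detA: "sqrt (det (A j)) = \<bar>det (R j)\<bar>" if "j < m" for j
    using R(1)[OF that] by (simp add: A_def det_mult[of _ "d j"] det_transpose power2_eq_square[symmetric])
  have hbi: "has_bochner_integral (lborel_vec (d j)) (f j) (1 / \<bar>det (R j)\<bar>)" if "j < m" for j
  proof (rule has_bochner_integral_nn_integral)
    have "A j \<in> carrier_mat (d j) (d j)" using A[OF that] by (simp add: pos_def_def)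
    from borel_measurable_quadratic_form[OF this]
    show "f j \<in> borel_measurable (lborel_vec (d j))" unfolding f_def by measurable
    show "(\<integral>\<^sup>+ x. ennreal (f j x) \<partial>lborel_vec (d j)) = ennreal (1 / \<bar>det (R j)\<bar>)"
      unfolding f_def using nn_integral_gaussian_vec[OF A[OF that]] detA[OF that] by simp
  qed (auto simp: f_def)
  then have int: "integral\<^sup>L (lborel_vec (d j)) (f j) = 1 / \<bar>det (R j)\<bar>" if "j < m" for j
    using that has_bochner_integral_integral_eq by blast
  have "BL_input m d f"
    using hbi R(2) int by (auto simp: BL_input_def f_def has_bochner_integral_iff)
  then have le: "(\<integral>\<^sup>+ x. ennreal (\<Prod>j<m. f j (B j *\<^sub>v x) powr c j) \<partial>lborel_vec n) /
        ennreal (\<Prod>j<m. (integral\<^sup>L (lborel_vec (d j)) (f j)) powr c j) \<le> ennreal K"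
    using K(1) unfolding BL_const_def by (auto simp: SUP_le_iff)
  have pd: "pos_def n (?G + e \<cdot>\<^sub>m 1\<^sub>m n)"
    unfolding pos_def_def
  proof (intro conjI ballI impI)
    have eI: "transpose_mat (e \<cdot>\<^sub>m 1\<^sub>m n) = e \<cdot>\<^sub>m 1\<^sub>m n" by (intro eq_matI) auto
    show "transpose_mat (?G + e \<cdot>\<^sub>m 1\<^sub>m n) = ?G + e \<cdot>\<^sub>m 1\<^sub>m n"
      using gram_sym[of m "\<lambda>j. R j * B j" d n c, OF RB] eI by (simp add: transpose_add[of _ n n])
    fix x :: "real vec" assume x: "x \<in> carrier_vec n" "x \<noteq> 0\<^sub>v n"
    have "0 < scalar_prod x x"
      using scalar_prod_self_nonneg[of x] scalar_prod_self_eq_0[OF x(1)] x(2) by (auto simp: less_le)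
    moreover have "0 \<le> scalar_prod x (?G *\<^sub>v x)"
      using c scalar_prod_self_nonneg
      by (subst gram_quadratic_form[OF RB x(1)]) (auto intro!: sum_nonneg mult_nonneg_nonneg simp: less_imp_le)
    ultimately show "0 < scalar_prod x ((?G + e \<cdot>\<^sub>m 1\<^sub>m n) *\<^sub>v x)"
      using e by (simp add: quadratic_form_add_smult_one[OF gram_carrier x(1)] add_nonneg_pos)
  qed simp
  let ?D = "det (?G + e \<cdot>\<^sub>m 1\<^sub>m n)"
  have D: "0 < ?D" using pos_def_det_pos[OF pd] .
  let ?P = "\<Prod>j<m. \<bar>det (R j)\<bar> powr c j"
  have P: "0 < ?P" using R(2) by (intro prod_pos) auto
  have "ennreal (1 / sqrt ?D) = (\<integral>\<^sup>+ x. ennreal (exp (- pi * scalar_prod x ((?G + e \<cdot>\<^sub>m 1\<^sub>m n) *\<^sub>v x))) \<partial>lborel_vec n)"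
    using nn_integral_gaussian_vec[OF pd] by simp
  \<comment> \<open>Dropping \<open>e I\<close> only enlarges the integrand, and without it the
    integrand is exactly the product of the test functions.\<close>
  also have "\<dots> \<le> (\<integral>\<^sup>+ x. ennreal (\<Prod>j<m. f j (B j *\<^sub>v x) powr c j) \<partial>lborel_vec n)"
  proof (intro nn_integral_mono ennreal_leI)
    fix x assume "x \<in> space (lborel_vec n)"
    then have x: "x \<in> carrier_vec n" by (auto simp: lborel_vec_def space_embed_measure)
    have "(\<Prod>j<m. f j (B j *\<^sub>v x) powr c j) = exp (\<Sum>j<m. - pi * (c j * scalar_prod ((R j * B j) *\<^sub>v x) ((R j * B j) *\<^sub>v x)))"
      unfolding exp_sum[OF finite_lessThan]
    proof (intro prod.cong refl)
      fix j assume "j \<in> {..<m}"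
      then have j: "j < m" by simp
      have Bx: "B j *\<^sub>v x \<in> carrier_vec (d j)" using B[OF j] x by simp
      have "(R j * B j) *\<^sub>v x = R j *\<^sub>v (B j *\<^sub>v x)" using R(1)[OF j] B[OF j] x by simp
      then show "f j (B j *\<^sub>v x) powr c j = exp (- pi * (c j * scalar_prod ((R j * B j) *\<^sub>v x) ((R j * B j) *\<^sub>v x)))"
        unfolding f_def A_def by (simp add: powr_def scalar_prod_transpose_mult[OF R(1)[OF j] Bx])
    qed
    also have "(\<Sum>j<m. - pi * (c j * scalar_prod ((R j * B j) *\<^sub>v x) ((R j * B j) *\<^sub>v x)))
       = - pi * scalar_prod x (?G *\<^sub>v x)"
      by (subst gram_quadratic_form[of m "\<lambda>j. R j * B j" d n x c, OF RB x]) (simp_all only: sum_distrib_left)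
    finally have *: "(\<Prod>j<m. f j (B j *\<^sub>v x) powr c j) = exp (- pi * scalar_prod x (?G *\<^sub>v x))" .
    have "0 \<le> scalar_prod x x" by (rule scalar_prod_self_nonneg)
    then show "exp (- pi * scalar_prod x ((?G + e \<cdot>\<^sub>m 1\<^sub>m n) *\<^sub>v x)) \<le> (\<Prod>j<m. f j (B j *\<^sub>v x) powr c j)"
      unfolding * using e by (simp add: quadratic_form_add_smult_one[OF gram_carrier x] mult_nonneg_nonneg distrib_left)
  qed
  finally have "ennreal (1 / sqrt ?D) / ennreal (1 / ?P) \<le>
     (\<integral>\<^sup>+ x. ennreal (\<Prod>j<m. f j (B j *\<^sub>v x) powr c j) \<partial>lborel_vec n) / ennreal (1 / ?P)"
    by (rule divide_right_mono_ennreal)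
  also have "1 / ?P = (\<Prod>j<m. (integral\<^sup>L (lborel_vec (d j)) (f j)) powr c j)"
    by (simp add: int powr_divide prod_dividef)
  also note le
  finally have "ennreal ((1 / sqrt ?D) / (1 / ?P)) \<le> ennreal K"
    using P D by (simp add: divide_ennreal int powr_divide prod_dividef)
  then have "?P / sqrt ?D \<le> K" using K(2) by simp
  then show ?thesis using D by (simp add: divide_le_eq)
qed

text \<open>Let \<open>e\<close> tend to 0 in \<open>BL_const_gaussian\<close> and square. The
  constant \<open>\<kappa>\<close> depends on the data only, not on \<open>R\<close>.\<close>

lemma BL_finite_gaussian_bound:
  assumes B: "\<And>j. j < m \<Longrightarrow> B j \<in> carrier_mat (d j) n"
    and c: "\<And>j. j < m \<Longrightarrow> 0 < c j" and fin: "BL_const m n d B c < \<infinity>"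
  obtains \<kappa> where "0 < \<kappa>"
    "\<And>R. (\<And>j. j < m \<Longrightarrow> R j \<in> carrier_mat (d j) (d j)) \<Longrightarrow> (\<And>j. j < m \<Longrightarrow> det (R j) \<noteq> 0) \<Longrightarrow>
      \<kappa> * (\<Prod>j<m. (det (R j))\<^sup>2 powr c j) \<le> det (gram n m c (\<lambda>j. R j * B j))"
proof -
  \<comment> \<open>The summand 1 makes \<open>K\<close> positive without a lower bound on the
    constant.\<close>
  define K where "K = enn2real (BL_const m n d B c) + 1"
  have K: "0 < K" by (simp add: K_def add_nonneg_pos)
  have BLK: "BL_const m n d B c \<le> ennreal K"
    using fin by (auto simp: K_def ennreal_enn2real_if less_top intro!: ennreal_leI order_trans[OF _ ennreal_leI[of "enn2real (BL_const m n d B c)"]])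
  show thesis
  proof (rule that[of "1 / K\<^sup>2"])
    fix R :: "nat \<Rightarrow> real mat"
    assume R: "\<And>j. j < m \<Longrightarrow> R j \<in> carrier_mat (d j) (d j)" "\<And>j. j < m \<Longrightarrow> det (R j) \<noteq> 0"
    let ?G = "gram n m c (\<lambda>j. R j * B j)"
    let ?P = "\<Prod>j<m. \<bar>det (R j)\<bar> powr c j"
    have "?P \<le> K * sqrt (det (?G + (1 / real (Suc i)) \<cdot>\<^sub>m 1\<^sub>m n))" for i
      using K by (intro BL_const_gaussian[OF B R c _ BLK]) auto
    moreover have "(\<lambda>i. K * sqrt (det (?G + (1 / real (Suc i)) \<cdot>\<^sub>m 1\<^sub>m n))) \<longlonglongrightarrow> K * sqrt (det ?G)"
    proof (intro tendsto_intros tendsto_det[where n = n])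
      fix i j assume "i < n" "j < n"
      moreover have "(\<lambda>s. ?G $$ (i, j) + 1 / real (Suc s) * 1\<^sub>m n $$ (i, j)) \<longlonglongrightarrow> ?G $$ (i, j) + 0 * 1\<^sub>m n $$ (i, j)"
        by (intro tendsto_add tendsto_mult tendsto_const LIMSEQ_Suc[OF lim_1_over_n])
      ultimately show "(\<lambda>s. (?G + (1 / real (Suc s)) \<cdot>\<^sub>m 1\<^sub>m n) $$ (i, j)) \<longlonglongrightarrow> ?G $$ (i, j)"
        using carrier_matD[OF gram_carrier[of n m c "\<lambda>j. R j * B j"]] by simp
    qed simp_all
    ultimately have le: "?P \<le> K * sqrt (det ?G)"
      by (intro LIMSEQ_le_const) auto
    have sq: "(\<bar>a\<bar> powr e)\<^sup>2 = a\<^sup>2 powr e" for a e :: real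
      using powr_mult[of "\<bar>a\<bar>" "\<bar>a\<bar>" e] by (simp add: power2_eq_square)
    have P: "0 < ?P" using R(2) by (intro prod_pos) auto
    \<comment> \<open>The root of a negative number is negative, so the positive lower bound forces
      \<open>det ?G > 0\<close>; squaring then removes the root.\<close>
    then have "0 < sqrt (det ?G)" using le K by (metis less_le_trans zero_less_mult_pos)
    moreover have "?P\<^sup>2 \<le> (K * sqrt (det ?G))\<^sup>2" using le P by (intro power_mono) auto
    ultimately have "?P\<^sup>2 \<le> K\<^sup>2 * det ?G" by (simp add: power_mult_distrib)
    moreover have "?P\<^sup>2 = (\<Prod>j<m. (det (R j))\<^sup>2 powr c j)"
      unfolding prod_power_distrib sq ..
    ultimately show "1 / K\<^sup>2 * (\<Prod>j<m. (det (R j))\<^sup>2 powr c j) \<le> det ?G"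
      using K by (simp add: field_simps)
  qed (use K in simp)
qed

section \<open>Sinkhorn scaling\<close>

lemma det_congruence:
  fixes T :: "real mat"
  assumes "T \<in> carrier_mat n n" "G \<in> carrier_mat n n"
  shows "det (transpose_mat T * G * T) = (det T)\<^sup>2 * det G"
proof -
  have "det (transpose_mat T * G * T) = det (transpose_mat T * G) * det T"
    using assms by (intro det_mult) auto
  also have "det (transpose_mat T * G) = det (transpose_mat T) * det G"
    using assms by (intro det_mult) auto
  also have "det (transpose_mat T) = det T" using assms(1) by (rule det_transpose)
  finally show ?thesis by (simp add: power2_eq_square)
qed

text \<open>Test on \<open>R j = t I\<close>: the two sides scale like \<open>t\<close> to the
  powers \<open>2 * (\<Sum>j<m. c j * d j)\<close> and \<open>2 * n\<close>. If these differ, a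
  suitable \<open>t\<close> violates the bound.\<close>

lemma scaling_condition:
  assumes B: "\<And>j. j < m \<Longrightarrow> B j \<in> carrier_mat (d j) n" and \<kappa>: "0 < \<kappa>"
    and bound: "\<And>R. (\<And>j. j < m \<Longrightarrow> R j \<in> carrier_mat (d j) (d j)) \<Longrightarrow> (\<And>j. j < m \<Longrightarrow> det (R j) \<noteq> 0) \<Longrightarrow>
      \<kappa> * (\<Prod>j<m. (det (R j))\<^sup>2 powr c j) \<le> det (gram n m c (\<lambda>j. R j * B j))"
  shows "(\<Sum>j<m. c j * real (d j)) = real n"
proof (rule ccontr)
  let ?D = "det (gram n m c B)"
  define p where "p = 2 * real n - 2 * (\<Sum>j<m. c j * real (d j))"
  assume "\<not> ?thesis"
  then have p: "p \<noteq> 0" by (simp add: p_def)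
  have le: "\<kappa> \<le> ?D * t powr p" if t: "0 < t" for t
  proof -
    have tp: "(t ^ k)\<^sup>2 = t powr (2 * real k)" for k
      using powr_realpow[OF t, of "k * 2"] by (simp add: power_mult mult.commute)
    let ?R = "\<lambda>j. t \<cdot>\<^sub>m 1\<^sub>m (d j)"
    have "\<kappa> * (\<Prod>j<m. (det (?R j))\<^sup>2 powr c j) \<le> det (gram n m c (\<lambda>j. ?R j * B j))"
      using t by (intro bound) auto
    \<comment> \<open>A scalar matrix passes from the left of \<open>B j\<close> to the right, where
      it acts by congruence on the Gram matrix.\<close>
    also have "gram n m c (\<lambda>j. ?R j * B j) = gram n m c (\<lambda>j. B j * (t \<cdot>\<^sub>m 1\<^sub>m n))"
    proof (rule gram_cong)
      fix j assume "j < m"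
      from B[OF this] show "?R j * B j = B j * (t \<cdot>\<^sub>m 1\<^sub>m n)"
        by (simp add: mult_smult_distrib[of _ "d j" n _ n] mult_smult_assoc_mat[of _ "d j" "d j" _ n])
    qed
    also have "\<dots> = transpose_mat (t \<cdot>\<^sub>m 1\<^sub>m n) * gram n m c B * (t \<cdot>\<^sub>m 1\<^sub>m n)"
      using B by (intro gram_mult_right) auto
    also have "det \<dots> = t ^ n * ?D * t ^ n"
      using det_congruence[of "t \<cdot>\<^sub>m 1\<^sub>m n" n "gram n m c B"] by (simp add: power2_eq_square mult.assoc mult.commute)
    also have "\<dots> = ?D * t powr (2 * real n)"
      using tp[of n] by (simp add: power2_eq_square)
    also have "(\<Prod>j<m. (det (?R j))\<^sup>2 powr c j) = t powr (2 * (\<Sum>j<m. c j * real (d j)))"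
    proof -
      have "(det (?R j))\<^sup>2 powr c j = t powr (2 * (c j * real (d j)))" for j
      proof -
        have "(det (?R j))\<^sup>2 = t powr (2 * real (d j))"
          using tp[of "d j"] by simp
        then show ?thesis by (simp add: powr_powr mult.commute mult.left_commute)
      qed
      then show ?thesis using t by (simp add: sum_distrib_left powr_sum)
    qed
    finally have "\<kappa> \<le> ?D * t powr (2 * real n) / t powr (2 * (\<Sum>j<m. c j * real (d j)))"
      using t by (simp add: pos_le_divide_eq)
    then show ?thesis by (simp add: p_def powr_diff)
  qed
  have D: "0 < ?D" using le[of 1] \<kappa> by simp
  \<comment> \<open>This \<open>t\<close> solves
    \<open>?D * t powr p = \<kappa> / 2\<close>.\<close>
  have "\<kappa> \<le> ?D * ((\<kappa> / (2 * ?D)) powr (1 / p)) powr p"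
    using D \<kappa> by (intro le) simp
  also have "\<dots> = \<kappa> / 2" using D \<kappa> p by (simp add: powr_powr)
  finally show False using \<kappa> by simp
qed

text \<open>Together with the scaling condition this fixes the trace at \<open>n\<close> for all
  coisometric competitors, so that only the determinant remains to be controlled.\<close>

lemma gram_trace_coisometry:
  assumes "\<And>j. j < m \<Longrightarrow> X j \<in> carrier_mat (d j) n"
    and "\<And>j. j < m \<Longrightarrow> X j * transpose_mat (X j) = 1\<^sub>m (d j)"
  shows "(\<Sum>i<n. gram n m c X $$ (i, i)) = (\<Sum>j<m. c j * real (d j))"
proof -
  have "(\<Sum>i<n. gram n m c X $$ (i, i)) = (\<Sum>j<m. c j * (\<Sum>l<d j. (X j * transpose_mat (X j)) $$ (l, l)))"
    using assms(1) by (rule gram_trace)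
  also have "\<dots> = (\<Sum>j<m. c j * real (d j))"
    using assms(2) by (intro sum.cong) simp_all
  finally show ?thesis .
qed

text \<open>
  Here \<open>U\<close> normalizes the Gram matrix and \<open>L j\<close> then normalizes the \<open>j\<close>-th component. The bound on
  the \<open>det (L j)\<close> comes from \<open>det P \<le> exp (tr P - k)\<close> for \<open>P = (X j U) (X j U)\<^sup>T\<close>: the exponents cancel because
  the normalized Gram matrix has trace \<open>n\<close>.
\<close>

lemma sinkhorn_step:
  assumes X: "\<And>j. j < m \<Longrightarrow> X j \<in> carrier_mat (d j) n"
    and XX: "\<And>j. j < m \<Longrightarrow> X j * transpose_mat (X j) = 1\<^sub>m (d j)"
    and c: "\<And>j. j < m \<Longrightarrow> 0 < c j" and dim: "(\<Sum>j<m. c j * real (d j)) = real n"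
    and det: "det (gram n m c X) \<noteq> 0"
  obtains U L where "U \<in> carrier_mat n n" "det U \<noteq> 0" "\<And>j. j < m \<Longrightarrow> L j \<in> carrier_mat (d j) (d j)"
    "\<And>j. j < m \<Longrightarrow> det (L j) \<noteq> 0"
    "\<And>j. j < m \<Longrightarrow> (L j * X j * U) * transpose_mat (L j * X j * U) = 1\<^sub>m (d j)"
    "(det U)\<^sup>2 * det (gram n m c X) = 1" "1 \<le> (\<Prod>j<m. (det (L j))\<^sup>2 powr c j)"
proof -
  obtain U where U: "U \<in> carrier_mat n n" "det U \<noteq> 0" "transpose_mat U * gram n m c X * U = 1\<^sub>m n"
    "(det U)\<^sup>2 * det (gram n m c X) = 1"
    using pos_def_congruent_one[OF gram_pos_def[OF X c det]] by blast
  define Z where "Z = (\<lambda>j. X j * U)"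
  have Z: "Z j \<in> carrier_mat (d j) n" if "j < m" for j using X[OF that] U(1) by (simp add: Z_def)
  have gramZ: "gram n m c Z = 1\<^sub>m n"
    unfolding Z_def U(3)[symmetric] by (rule gram_mult_right[OF X U(1)])
  have P: "pos_def (d j) (Z j * transpose_mat (Z j))" if j: "j < m" for j
  proof -
    \<comment> \<open>With \<open>V\<close> inverse to the transpose of \<open>U\<close>, the matrix
      \<open>X j * V\<close> is a left inverse of \<open>transpose_mat (Z j)\<close>, because
      \<open>X j\<close> is coisometric. Hence \<open>Z j * transpose_mat (Z j)\<close> is
      definite.\<close>
    obtain V where V: "V \<in> carrier_mat n n" "V * transpose_mat U = 1\<^sub>m n"
      using obtain_inverse_mat[of "transpose_mat U" n] U(1,2) det_transpose[OF U(1)] by auto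
    have tZ: "transpose_mat (Z j) = transpose_mat U * transpose_mat (X j)"
      unfolding Z_def by (rule transpose_mult[OF X[OF j] U(1)])
    have "X j * V * transpose_mat (Z j) = X j * (V * transpose_mat U) * transpose_mat (X j)"
      unfolding tZ using X[OF j] U(1) V(1)
      by (simp add: assoc_mult_mat[of _ "d j" n _ n _ "d j"] assoc_mult_mat[of _ "d j" n _ n _ n]
          assoc_mult_mat[of _ n n _ n _ "d j"])
    then have inv: "X j * V * transpose_mat (Z j) = 1\<^sub>m (d j)"
      using V(2) X[OF j] XX[OF j] by simp
    have tc: "transpose_mat (Z j) \<in> carrier_mat n (d j)" "X j * V \<in> carrier_mat (d j) n"
      using Z[OF j] X[OF j] V(1) by auto
    have "pos_def (d j) (transpose_mat (transpose_mat (Z j)) * transpose_mat (Z j))"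
      by (rule pos_def_transpose_mult[OF tc(1) mult_mat_vec_eq_0[OF tc inv]])
    then show ?thesis by simp
  qed
  have "\<exists>V. V \<in> carrier_mat (d j) (d j) \<and> det V \<noteq> 0 \<and>
      transpose_mat V * (Z j * transpose_mat (Z j)) * V = 1\<^sub>m (d j) \<and>
      (det V)\<^sup>2 * det (Z j * transpose_mat (Z j)) = 1" if "j < m" for j
    using pos_def_congruent_one[OF P[OF that]] by blast
  then obtain V where V: "\<And>j. j < m \<Longrightarrow> V j \<in> carrier_mat (d j) (d j)" "\<And>j. j < m \<Longrightarrow> det (V j) \<noteq> 0"
      "\<And>j. j < m \<Longrightarrow> transpose_mat (V j) * (Z j * transpose_mat (Z j)) * V j = 1\<^sub>m (d j)"
      "\<And>j. j < m \<Longrightarrow> (det (V j))\<^sup>2 * det (Z j * transpose_mat (Z j)) = 1"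
    by metis
  define L where "L = (\<lambda>j. transpose_mat (V j))"
  have L: "L j \<in> carrier_mat (d j) (d j)" "det (L j) = det (V j)" if "j < m" for j
    using V(1)[OF that] by (auto simp: L_def det_transpose)
  have one: "(L j * X j * U) * transpose_mat (L j * X j * U) = 1\<^sub>m (d j)" if j: "j < m" for j
  proof -
    have LXU: "L j * X j * U = L j * Z j"
      unfolding Z_def by (rule assoc_mult_mat[OF L(1)[OF j] X[OF j] U(1)])
    have tL: "transpose_mat (L j * Z j) = transpose_mat (Z j) * V j"
      using transpose_mult[OF L(1)[OF j] Z[OF j]] by (simp add: L_def)
    have "(L j * Z j) * (transpose_mat (Z j) * V j) = L j * (Z j * transpose_mat (Z j)) * V j"
      using L(1)[OF j] Z[OF j] V(1)[OF j]
      by (simp add: assoc_mult_mat[of _ "d j" "d j" _ n _ "d j"] assoc_mult_mat[of _ "d j" "d j" _ "d j" _ "d j"]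
          assoc_mult_mat[of _ "d j" n _ "d j" _ "d j"])
    then show ?thesis unfolding LXU tL using V(3)[OF j] by (simp add: L_def)
  qed
  define \<tau> where "\<tau> = (\<lambda>j. \<Sum>l<d j. (Z j * transpose_mat (Z j)) $$ (l, l))"
  have "(\<Sum>j<m. c j * \<tau> j) = (\<Sum>i<n. gram n m c Z $$ (i, i))"
    unfolding \<tau>_def by (rule gram_trace[OF Z, symmetric])
  then have \<tau>: "(\<Sum>j<m. c j * \<tau> j) = real n" by (simp add: gramZ)
  \<comment> \<open>The exponent is 0, since both weighted sums equal \<open>n\<close>: one by the
    dimension condition, the other by the trace of the normalized Gram matrix.\<close>
  have "1 = exp (\<Sum>j<m. c j * (real (d j) - \<tau> j))"
    using \<tau> dim by (simp add: right_diff_distrib sum_subtractf)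
  also have "\<dots> = (\<Prod>j<m. exp (real (d j) - \<tau> j) powr c j)"
    by (simp add: exp_sum powr_def mult.commute)
  also have "\<dots> \<le> (\<Prod>j<m. (det (L j))\<^sup>2 powr c j)"
  proof (intro prod_mono conjI powr_mono2)
    fix j assume "j \<in> {..<m}"
    then have j: "j < m" by simp
    show "0 \<le> c j" using c[OF j] by simp
    let ?p = "det (Z j * transpose_mat (Z j))"
    have p: "0 < ?p" using pos_def_det_pos[OF P[OF j]] .
    have "exp (real (d j) - \<tau> j) * ?p \<le> exp (real (d j) - \<tau> j) * exp (\<tau> j - real (d j))"
      using det_le_exp_trace[OF P[OF j]] by (intro mult_left_mono) (auto simp: \<tau>_def)
    also have "\<dots> = (det (L j))\<^sup>2 * ?p" using V(4)[OF j] L(2)[OF j] by (simp add: exp_add[symmetric])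
    finally show "exp (real (d j) - \<tau> j) \<le> (det (L j))\<^sup>2" using p by simp
  qed auto
  finally show thesis using that[OF U(1,2) L(1) _ one U(4)] L(2) V(2) by simp
qed

text \<open>Take a competitor with \<open>v > \<delta> * Sup S\<close>. A Sinkhorn step yields a
  competitor of value at least \<open>v / D\<close>, which cannot exceed \<open>Sup S\<close>; hence
  \<open>D > \<delta>\<close>.\<close>

lemma gram_det_approx_one:
  assumes B: "\<And>j. j < m \<Longrightarrow> B j \<in> carrier_mat (d j) n"
    and BB: "\<And>j. j < m \<Longrightarrow> B j * transpose_mat (B j) = 1\<^sub>m (d j)"
    and c: "\<And>j. j < m \<Longrightarrow> 0 < c j" and fin: "BL_const m n d B c < \<infinity>" and \<delta>: "\<delta> < 1"
  obtains R T where "T \<in> carrier_mat n n" "det T \<noteq> 0" "\<And>j. j < m \<Longrightarrow> R j \<in> carrier_mat (d j) (d j)"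
    "\<And>j. j < m \<Longrightarrow> det (R j) \<noteq> 0"
    "\<And>j. j < m \<Longrightarrow> (R j * B j * T) * transpose_mat (R j * B j * T) = 1\<^sub>m (d j)"
    "\<delta> < det (gram n m c (\<lambda>j. R j * B j * T))" "(\<Sum>j<m. c j * real (d j)) = real n"
proof -
  obtain \<kappa> where \<kappa>: "0 < \<kappa>" and bound: "\<And>R. (\<And>j. j < m \<Longrightarrow> R j \<in> carrier_mat (d j) (d j)) \<Longrightarrow>
      (\<And>j. j < m \<Longrightarrow> det (R j) \<noteq> 0) \<Longrightarrow>
      \<kappa> * (\<Prod>j<m. (det (R j))\<^sup>2 powr c j) \<le> det (gram n m c (\<lambda>j. R j * B j))"
    using BL_finite_gaussian_bound[where B = B, OF B c fin] by blast
  have dim: "(\<Sum>j<m. c j * real (d j)) = real n"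
    using scaling_condition[where B = B, OF B \<kappa> bound] .
  \<comment> \<open>\<open>Y\<close> is the set of competitors, \<open>v\<close> the functional to
    be maximized and \<open>D\<close> the determinant of the Gram matrix. From
    \<open>\<kappa> * v \<le> D \<le> 1\<close> follows the bound \<open>1 / \<kappa>\<close> on
    \<open>v\<close>.\<close>
  define Y where "Y = (\<lambda>R T. T \<in> carrier_mat n n \<and> det T \<noteq> 0 \<and> (\<forall>j<m. R j \<in> carrier_mat (d j) (d j) \<and>
    det (R j) \<noteq> 0 \<and> (R j * B j * T) * transpose_mat (R j * B j * T) = 1\<^sub>m (d j)))"
  define v where "v = (\<lambda>R T. (det T)\<^sup>2 * (\<Prod>j<m. (det (R j))\<^sup>2 powr c j))"
  define D where "D = (\<lambda>R T. det (gram n m c (\<lambda>j. R j * B j * T)))"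
  have vpos: "0 < v R T" if "Y R T" for R T
    using that by (auto simp: v_def Y_def intro!: mult_pos_pos prod_pos)
  have carr: "R j * B j * T \<in> carrier_mat (d j) n" "R j * B j \<in> carrier_mat (d j) n" if "Y R T" "j < m" for R T j
    using that B[OF that(2)] by (auto simp: Y_def)
  have Dv: "\<kappa> * v R T \<le> D R T" if "Y R T" for R T
  proof -
    have T: "T \<in> carrier_mat n n" using that by (simp add: Y_def)
    have "D R T = det (transpose_mat T * gram n m c (\<lambda>j. R j * B j) * T)"
      unfolding D_def using carr[OF that] T by (subst gram_mult_right[of m _ d n]) auto
    also have "\<dots> = (det T)\<^sup>2 * det (gram n m c (\<lambda>j. R j * B j))"
      using T by (intro det_congruence) auto
    also have "\<dots> \<ge> (det T)\<^sup>2 * (\<kappa> * (\<Prod>j<m. (det (R j))\<^sup>2 powr c j))"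
      using that by (intro mult_left_mono bound) (auto simp: Y_def)
    finally show ?thesis by (simp add: v_def mult_ac)
  qed
  have Dpos: "0 < D R T" if "Y R T" for R T
    using Dv[OF that] vpos[OF that] \<kappa> by (meson less_le_trans mult_pos_pos)
  have D1: "D R T \<le> 1" if "Y R T" for R T
  proof -
    let ?G = "gram n m c (\<lambda>j. R j * B j * T)"
    have "pos_def n ?G"
      using carr[OF that] c Dpos[OF that] by (intro gram_pos_def[where d = d]) (auto simp: D_def)
    then have "D R T \<le> exp ((\<Sum>i<n. ?G $$ (i, i)) - real n)"
      unfolding D_def by (rule det_le_exp_trace)
    also have "(\<Sum>i<n. ?G $$ (i, i)) = real n"
      unfolding dim[symmetric] using carr[OF that] that
      by (intro gram_trace_coisometry) (auto simp: Y_def)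
    finally show ?thesis by simp
  qed
  define S where "S = {v R T |R T. Y R T}"
  have B1: "1\<^sub>m (d j) * B j * 1\<^sub>m n = B j" if "j < m" for j using B[OF that] by simp
  \<comment> \<open>The trivial scaling is a competitor because \<open>B\<close> itself is
    coisometric; it makes the supremum positive.\<close>
  have Y1: "Y (\<lambda>j. 1\<^sub>m (d j)) (1\<^sub>m n)" using BB by (auto simp: Y_def B1)
  have ne: "S \<noteq> {}" using Y1 by (auto simp: S_def)
  have "s \<le> 1 / \<kappa>" if s: "s \<in> S" for s
  proof -
    obtain R T where "Y R T" "s = v R T" using s by (auto simp: S_def)
    then have "\<kappa> * s \<le> 1" using Dv[of R T] D1[of R T] by simp
    then show ?thesis using \<kappa> by (simp add: pos_le_divide_eq mult.commute)
  qed
  then have bdd: "bdd_above S" by (intro bdd_aboveI)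
  have up: "v R T \<le> Sup S" if "Y R T" for R T
    using that bdd by (intro cSup_upper) (auto simp: S_def)
  have Spos: "0 < Sup S" using vpos[OF Y1] up[OF Y1] by linarith
  define \<delta>' where "\<delta>' = max \<delta> 0"
  have "\<delta>' * Sup S < Sup S" using Spos \<delta> by (simp add: \<delta>'_def)
  then obtain R T where RT: "Y R T" and big: "\<delta>' * Sup S < v R T"
    using less_cSup_iff[OF ne bdd] by (auto simp: S_def)
  have T: "T \<in> carrier_mat n n" "det T \<noteq> 0" and R: "\<And>j. j < m \<Longrightarrow> R j \<in> carrier_mat (d j) (d j)" "\<And>j. j < m \<Longrightarrow> det (R j) \<noteq> 0"
    and XX: "\<And>j. j < m \<Longrightarrow> (R j * B j * T) * transpose_mat (R j * B j * T) = 1\<^sub>m (d j)"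
    using RT by (auto simp: Y_def)
  obtain U L where U: "U \<in> carrier_mat n n" "det U \<noteq> 0" and L: "\<And>j. j < m \<Longrightarrow> L j \<in> carrier_mat (d j) (d j)"
    "\<And>j. j < m \<Longrightarrow> det (L j) \<noteq> 0"
    and LL: "\<And>j. j < m \<Longrightarrow> (L j * (R j * B j * T) * U) * transpose_mat (L j * (R j * B j * T) * U) = 1\<^sub>m (d j)"
    and dU: "(det U)\<^sup>2 * D R T = 1" and PL: "1 \<le> (\<Prod>j<m. (det (L j))\<^sup>2 powr c j)"
    unfolding D_def
    by (rule sinkhorn_step[of m "\<lambda>j. R j * B j * T" d n c, OF carr(1)[OF RT] XX c dim])
      (use Dpos[OF RT] in \<open>auto simp: D_def\<close>)
  have assoc: "L j * (R j * B j * T) * U = (L j * R j) * B j * (T * U)" if j: "j < m" for j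
  proof -
    note cs = L(1)[OF j] R(1)[OF j] B[OF j] T(1) U(1)
    have "L j * (R j * B j * T) = L j * (R j * B j) * T"
      using cs by (intro assoc_mult_mat[symmetric, of _ "d j" "d j" _ n _ n]) auto
    also have "L j * (R j * B j) = L j * R j * B j"
      using cs by (intro assoc_mult_mat[symmetric]) auto
    finally have "L j * (R j * B j * T) * U = L j * R j * B j * T * U" by simp
    also have "\<dots> = L j * R j * B j * (T * U)"
      using cs by (intro assoc_mult_mat[of _ "d j" n _ n _ n]) auto
    finally show ?thesis .
  qed
  \<comment> \<open>The Sinkhorn step composes with the given scalings, so its result is again a
    competitor for the same \<open>B\<close>.\<close>
  have "Y (\<lambda>j. L j * R j) (T * U)"
    unfolding Y_def
  proof (intro conjI allI impI)
    fix j assume j: "j < m"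
    show "L j * R j \<in> carrier_mat (d j) (d j)" using L(1)[OF j] R(1)[OF j] by simp
    show "det (L j * R j) \<noteq> 0" using L[OF j] R[OF j] by (simp add: det_mult[of _ "d j"])
    show "(L j * R j * B j * (T * U)) * transpose_mat (L j * R j * B j * (T * U)) = 1\<^sub>m (d j)"
      using LL[OF j] unfolding assoc[OF j] .
  qed (use T U in \<open>simp_all add: det_mult[of _ n]\<close>)
  then have "v (\<lambda>j. L j * R j) (T * U) \<le> Sup S" by (rule up)
  also have "v (\<lambda>j. L j * R j) (T * U) = v R T * (det U)\<^sup>2 * (\<Prod>j<m. (det (L j))\<^sup>2 powr c j)"
  proof -
    have "(\<Prod>j<m. (det (L j * R j))\<^sup>2 powr c j) = (\<Prod>j<m. (det (L j))\<^sup>2 powr c j * (det (R j))\<^sup>2 powr c j)"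
      by (intro prod.cong refl) (simp add: det_mult[OF L(1) R(1)] power_mult_distrib powr_mult)
    then show ?thesis using T(1) U(1)
      by (simp add: v_def det_mult[of _ n] power_mult_distrib prod.distrib mult_ac)
  qed
  finally have "v R T * (det U)\<^sup>2 * (\<Prod>j<m. (det (L j))\<^sup>2 powr c j) \<le> Sup S" .
  moreover have "v R T * (det U)\<^sup>2 * 1 \<le> v R T * (det U)\<^sup>2 * (\<Prod>j<m. (det (L j))\<^sup>2 powr c j)"
    using PL vpos[OF RT] by (intro mult_left_mono) auto
  ultimately have "v R T * (det U)\<^sup>2 * D R T \<le> Sup S * D R T"
    using Dpos[OF RT] by (intro mult_right_mono) auto
  then have "v R T \<le> Sup S * D R T" using dU by (simp add: mult.assoc)
  with big have "Sup S * \<delta>' < Sup S * D R T" by (simp add: mult.commute)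
  then have "\<delta> < D R T" using Spos by (simp add: \<delta>'_def)
  then show thesis using that[OF T R XX _ dim] by (simp add: D_def)
qed

section \<open>Compactness\<close>

text \<open>Bolzano-Weierstrass for one index after another, each time refining the subsequence. The
  indices will be the positions \<open>(j, a, b)\<close> of matrix entries.\<close>

lemma finite_family_convergent_subsequence:
  fixes f :: "nat \<Rightarrow> 'i \<Rightarrow> real"
  assumes "finite I" "\<And>k i. i \<in> I \<Longrightarrow> \<bar>f k i\<bar> \<le> C"
  obtains r l where "strict_mono (r :: nat \<Rightarrow> nat)" "\<And>i. i \<in> I \<Longrightarrow> (\<lambda>k. f (r k) i) \<longlonglongrightarrow> l i"
proof -
  have "\<exists>r. strict_mono (r :: nat \<Rightarrow> nat) \<and> (\<forall>i\<in>I. convergent (\<lambda>k. f (r k) i))"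
    using assms
  proof (induction I)
    case empty
    show ?case by (intro exI[of _ id]) (simp add: strict_mono_def)
  next
    case (insert i I)
    have "\<exists>r. strict_mono (r :: nat \<Rightarrow> nat) \<and> (\<forall>i\<in>I. convergent (\<lambda>k. f (r k) i))"
      using insert.prems by (intro insert.IH) simp
    then obtain r where r: "strict_mono r" "\<And>i. i \<in> I \<Longrightarrow> convergent (\<lambda>k. f (r k) i)" by blast
    have "bounded (range (\<lambda>k. f (r k) i))"
      using insert.prems by (intro boundedI[of _ C]) auto
    then obtain s l where s: "strict_mono s" "((\<lambda>k. f (r k) i) \<circ> s) \<longlonglongrightarrow> l"
      using bounded_imp_convergent_subsequence by blast
    have "convergent (\<lambda>k. f (r (s k)) i')" if "i' \<in> insert i I" for i'
    proof (cases "i' = i")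
      case True
      then show ?thesis using s(2) by (auto simp: convergent_def o_def)
    next
      case False
      then show ?thesis
        using convergent_subseq_convergent[OF r(2) s(1), of i'] that by (simp add: o_def)
    qed
    moreover have "strict_mono (r \<circ> s)" using r(1) s(1) by (rule strict_mono_o)
    ultimately show ?case by (intro exI[of _ "r \<circ> s"] conjI) (simp_all add: o_def)
  qed
  then obtain r where "strict_mono r" "\<And>i. i \<in> I \<Longrightarrow> convergent (\<lambda>k. f (r k) i)" by blast
  then show thesis using that[of r "\<lambda>i. lim (\<lambda>k. f (r k) i)"] by (simp add: convergent_LIMSEQ_iff)
qed

text \<open>Half of the equivalence of norms: expanding in matrix units, any norm is dominated by a
  weighted sum of absolute entries. Entrywise convergence thus implies convergence in
  \<open>N\<close>.\<close>

lemma mt_norm_entry_bound: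
  assumes N: "mt_norm m n d N"
  obtains w where "\<And>A. A \<in> mtrans m n d \<Longrightarrow>
    N A \<le> (\<Sum>(j, a, b)\<in>(SIGMA j:{..<m}. {..<d j} \<times> {..<n}). \<bar>A j $$ (a, b)\<bar> * w (j, a, b))"
proof
  define I where "I = (SIGMA j:{..<m}. {..<d j} \<times> {..<n})"
  \<comment> \<open>\<open>E s\<close> is the matrix unit at position \<open>s\<close>; its norm is
    the weight of that position.\<close>
  define E where "E = (\<lambda>s. \<lambda>j\<in>{..<m}. Matrix.mat (d j) n (\<lambda>(a, b). if (j, a, b) = s then 1 else 0 :: real))"
  fix A assume A: "A \<in> mtrans m n d"
  \<comment> \<open>\<open>res S\<close> keeps only the entries of \<open>A\<close> at positions in
    \<open>S\<close>, so the triangle inequality can be applied to one position at a time.\<close>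
  define res where "res = (\<lambda>S. \<lambda>j\<in>{..<m}. Matrix.mat (d j) n (\<lambda>(a, b). if (j, a, b) \<in> S then A j $$ (a, b) else 0))"
  have Ac: "A j \<in> carrier_mat (d j) n" if "j < m" for j using A that by (auto simp: mtrans_def)
  have res: "res S \<in> mtrans m n d" for S by (auto simp: res_def mtrans_def)
  have E: "E s \<in> mtrans m n d" for s by (auto simp: E_def mtrans_def)
  have bound: "N (res S) \<le> (\<Sum>(j, a, b)\<in>S. \<bar>A j $$ (a, b)\<bar> * N (E (j, a, b)))" if "finite S" for S
    using that
  proof (induction S)
    case empty
    have "res {} = mt_zero m n d" by (auto simp: res_def mt_zero_def intro!: restrict_ext eq_matI)
    moreover from this have "mt_zero m n d \<in> mtrans m n d" using res[of "{}"] by simp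
    with N have "N (mt_zero m n d) = 0" unfolding mt_norm_def by blast
    ultimately show ?case by simp
  next
    case (insert s S)
    obtain j a b where s: "s = (j, a, b)" by (cases s)
    let ?x = "A j $$ (a, b)"
    have sc: "mt_scale m ?x (E s) \<in> mtrans m n d" by (auto simp: mt_scale_def E_def mtrans_def)
    have "res (insert s S) = mt_add m (res S) (mt_scale m ?x (E s))"
      using insert.hyps(2) unfolding res_def mt_add_def mt_scale_def E_def s
      by (intro restrict_ext eq_matI) auto
    then have "N (res (insert s S)) \<le> N (res S) + N (mt_scale m ?x (E s))"
      using N res[of S] sc by (auto simp: mt_norm_def)
    also have "N (mt_scale m ?x (E s)) = \<bar>?x\<bar> * N (E s)"
      using N E by (auto simp: mt_norm_def)
    finally show ?case using insert by (simp add: s)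
  qed
  have "res I = A"
  proof
    fix j
    show "res I j = A j"
    proof (cases "j < m")
      case True
      then show ?thesis using Ac[OF True] by (intro eq_matI) (auto simp: res_def I_def)
    next
      case False
      then show ?thesis using A by (auto simp: res_def mtrans_def PiE_def extensional_def)
    qed
  qed
  moreover have "finite I" by (auto simp: I_def)
  ultimately show "N A \<le> (\<Sum>(j, a, b)\<in>I. \<bar>A j $$ (a, b)\<bar> * (N \<circ> E) (j, a, b))"
    using bound[of I] by simp
qed

text \<open>The rows of a coisometry are unit vectors. This is the boundedness behind the
  compactness argument.\<close>

lemma coisometry_entry_le_1:
  fixes X :: "real mat"
  assumes "X \<in> carrier_mat r n" "X * transpose_mat X = 1\<^sub>m r" "a < r" "b < n"
  shows "\<bar>X $$ (a, b)\<bar> \<le> 1"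
proof -
  have "(X $$ (a, b))\<^sup>2 \<le> (\<Sum>b<n. (X $$ (a, b))\<^sup>2)"
    using assms(4) by (intro member_le_sum) auto
  also have "\<dots> = (X * transpose_mat X) $$ (a, a)"
    using assms(1,3) by (simp add: scalar_prod_def lessThan_atLeast0 power2_eq_square)
  also have "\<dots> = 1" using assms(2,3) by simp
  finally show ?thesis by (simp add: abs_le_square_iff[of _ 1, simplified])
qed

section \<open>Approximation within the equivalence class and passage to the limit\<close>

lemma class_member_approx:
  assumes "B \<in> BL_F m n d c" "\<And>j. j < m \<Longrightarrow> 0 < c j" "\<delta> < 1"
  shows "\<exists>B'\<in>mt_class m n d B. (\<forall>j<m. B' j * transpose_mat (B' j) = 1\<^sub>m (d j)) \<and>
    \<delta> < det (gram n m c B') \<and> (\<Sum>j<m. c j * real (d j)) = real n"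
proof -
  have B: "\<And>j. j < m \<Longrightarrow> B j \<in> carrier_mat (d j) n"
    and BB: "\<And>j. j < m \<Longrightarrow> B j * transpose_mat (B j) = 1\<^sub>m (d j)"
    and fin: "BL_const m n d B c < \<infinity>"
    using assms(1) by (auto simp: BL_F_def mtrans_def)
  show ?thesis
  proof (rule gram_det_approx_one[where B = B, OF B BB assms(2) fin assms(3)])
    fix R :: "nat \<Rightarrow> real mat" and T :: "real mat"
    assume T: "T \<in> carrier_mat n n" "det T \<noteq> 0" and R: "\<And>j. j < m \<Longrightarrow> R j \<in> carrier_mat (d j) (d j)"
      "\<And>j. j < m \<Longrightarrow> det (R j) \<noteq> 0"
      and X: "\<And>j. j < m \<Longrightarrow> (R j * B j * T) * transpose_mat (R j * B j * T) = 1\<^sub>m (d j)"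
      and D: "\<delta> < det (gram n m c (\<lambda>j. R j * B j * T))" and dim: "(\<Sum>j<m. c j * real (d j)) = real n"
    define B' where "B' = (\<lambda>j\<in>{..<m}. R j * B j * T)"
    have "\<exists>S. S \<in> carrier_mat (d j) (d j) \<and> inverts_mat S (R j) \<and> inverts_mat (R j) S" if j: "j < m" for j
    proof -
      obtain S where "S \<in> carrier_mat (d j) (d j)" "R j * S = 1\<^sub>m (d j)" "S * R j = 1\<^sub>m (d j)"
        using obtain_inverse_mat[OF R(1)[OF j] R(2)[OF j]] by blast
      then show ?thesis using R(1)[OF j] by (intro exI[of _ S]) (auto simp: inverts_mat_def)
    qed
    then have "\<forall>j. \<exists>S. j < m \<longrightarrow> S \<in> carrier_mat (d j) (d j) \<and> inverts_mat S (R j) \<and> inverts_mat (R j) S"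
      by blast
    from choice[OF this] obtain S where S: "\<And>j. j < m \<Longrightarrow>
        S j \<in> carrier_mat (d j) (d j) \<and> inverts_mat (S j) (R j) \<and> inverts_mat (R j) (S j)"
      by blast
    have "B' \<in> mtrans m n d"
      using mult_carrier_mat[OF mult_carrier_mat[OF R(1) B] T(1)] by (auto simp: B'_def mtrans_def)
    moreover have "\<forall>j<m. S j \<in> carrier_mat (d j) (d j) \<and> R j \<in> carrier_mat (d j) (d j) \<and>
       inverts_mat (S j) (R j) \<and> inverts_mat (R j) (S j) \<and> B' j = R j * B j * T"
      using S R by (auto simp: B'_def)
    \<comment> \<open>In \<open>mt_class\<close> the left factor is the inverse of the
      transformation of the target, so \<open>R\<close> and \<open>S\<close> are exchanged in the
      witnesses.\<close>
    ultimately have "B' \<in> mt_class m n d B"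
      unfolding mt_class_def using T invertible_mat_if_det[OF T]
      by (intro CollectI conjI exI[of _ T] exI[of _ S] exI[of _ R]) assumption+
    moreover have "gram n m c B' = gram n m c (\<lambda>j. R j * B j * T)"
      by (rule gram_cong) (simp add: B'_def)
    ultimately show ?thesis using X D dim by (intro bexI[of _ B']) (auto simp: B'_def)
  qed
qed

theorem theorem2p3:
  fixes m n :: nat and d :: "nat \<Rightarrow> nat" and c :: "nat \<Rightarrow> real"
    and B :: "nat \<Rightarrow> real mat" and N :: "(nat \<Rightarrow> real mat) \<Rightarrow> real" and \<epsilon> :: real
  assumes "0 < m" and "0 < n" and "\<And>j. j < m \<Longrightarrow> 0 < d j"
    and "\<And>j. j < m \<Longrightarrow> 0 < c j"
    and "mt_norm m n d N"
    and "B \<in> BL_F m n d c"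
    and "0 < \<epsilon>"
  shows "\<exists>B'\<in>mt_class m n d B. \<exists>G\<in>BL_G m n d c. N (mt_diff m B' G) < \<epsilon>"
proof -
  note c = assms(4)
  have "\<exists>X\<in>mt_class m n d B. (\<forall>j<m. X j * transpose_mat (X j) = 1\<^sub>m (d j)) \<and>
    1 - 1 / real (Suc k) < det (gram n m c X) \<and> (\<Sum>j<m. c j * real (d j)) = real n" for k
    using c by (intro class_member_approx[OF assms(6)]) auto
  then have "\<forall>k. \<exists>X. X \<in> mt_class m n d B \<and> (\<forall>j<m. X j * transpose_mat (X j) = 1\<^sub>m (d j)) \<and>
    1 - 1 / real (Suc k) < det (gram n m c X) \<and> (\<Sum>j<m. c j * real (d j)) = real n"
    by blast
  from choice[OF this] obtain X where Xcl: "\<And>k. X k \<in> mt_class m n d B"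
    and XX: "\<And>k j. j < m \<Longrightarrow> X k j * transpose_mat (X k j) = 1\<^sub>m (d j)"
    and Xdet: "\<And>k. 1 - 1 / real (Suc k) < det (gram n m c (X k))"
    and dim: "(\<Sum>j<m. c j * real (d j)) = real n"
    by blast
  have Xm: "X k \<in> mtrans m n d" for k using Xcl[of k] by (simp add: mt_class_def)
  have Xc: "X k j \<in> carrier_mat (d j) n" if "j < m" for k j using Xm[of k] that by (auto simp: mtrans_def)
  define I where "I = (SIGMA j:{..<m}. {..<d j} \<times> {..<n})"
  define f where "f = (\<lambda>k (j, a, b). X k j $$ (a, b))"
  have "finite I" by (auto simp: I_def)
  moreover have "\<bar>f k i\<bar> \<le> 1" if "i \<in> I" for k i
    using that coisometry_entry_le_1[OF Xc XX] by (auto simp: I_def f_def)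
  ultimately obtain r l where r: "strict_mono (r :: nat \<Rightarrow> nat)"
    and l: "\<And>i. i \<in> I \<Longrightarrow> (\<lambda>k. f (r k) i) \<longlonglongrightarrow> l i"
    using finite_family_convergent_subsequence[of I f 1] by blast
  \<comment> \<open>\<open>G\<close> is the entrywise limit. Coisometry, the trace and the
    determinant are polynomial in the entries and pass to it.\<close>
  define G where "G = (\<lambda>j\<in>{..<m}. Matrix.mat (d j) n (\<lambda>(a, b). l (j, a, b)))"
  have Gc: "G j \<in> carrier_mat (d j) n" if "j < m" for j using that by (simp add: G_def)
  have Gm: "G \<in> mtrans m n d" by (auto simp: G_def mtrans_def)
  have lim: "(\<lambda>k. X (r k) j $$ (a, b)) \<longlonglongrightarrow> G j $$ (a, b)" if "j < m" "a < d j" "b < n" for j a b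
    using l[of "(j, a, b)"] that by (simp add: I_def f_def G_def)
  have GG: "G j * transpose_mat (G j) = 1\<^sub>m (d j)" if j: "j < m" for j
  proof (rule eq_matI)
    fix a b assume "a < dim_row (1\<^sub>m (d j) :: real mat)" "b < dim_col (1\<^sub>m (d j) :: real mat)"
    then have ab: "a < d j" "b < d j" by auto
    have ent: "(A * transpose_mat A) $$ (a, b) = (\<Sum>i<n. A $$ (a, i) * A $$ (b, i))"
      if "A \<in> carrier_mat (d j) n" for A :: "real mat"
      using that ab by (simp add: scalar_prod_def lessThan_atLeast0)
    have "(\<lambda>k. (X (r k) j * transpose_mat (X (r k) j)) $$ (a, b)) \<longlonglongrightarrow> (G j * transpose_mat (G j)) $$ (a, b)"
      unfolding ent[OF Xc[OF j]] ent[OF Gc[OF j]] using j ab by (intro tendsto_intros lim) auto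
    then have "(\<lambda>k. (1\<^sub>m (d j) :: real mat) $$ (a, b)) \<longlonglongrightarrow> (G j * transpose_mat (G j)) $$ (a, b)"
      by (simp only: XX[OF j])
    from LIMSEQ_unique[OF this tendsto_const]
    show "(G j * transpose_mat (G j)) $$ (a, b) = 1\<^sub>m (d j) $$ (a, b)" .
  qed (use Gc[OF j] in auto)
  have lim_det: "(\<lambda>k. det (gram n m c (X (r k)))) \<longlonglongrightarrow> det (gram n m c G)"
  proof (rule tendsto_det[of _ n])
    fix i j assume "i < n" "j < n"
    then show "(\<lambda>k. gram n m c (X (r k)) $$ (i, j)) \<longlonglongrightarrow> gram n m c G $$ (i, j)"
      by (subst (1 2) gram_index[of m _ d]) (auto intro!: tendsto_intros lim Xc Gc)
  qed simp_all
  have lim_1: "(\<lambda>k. 1 - 1 / real (Suc (r k))) \<longlonglongrightarrow> 1 - 0"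
    by (intro tendsto_diff tendsto_const LIMSEQ_subseq_LIMSEQ[OF LIMSEQ_Suc[OF lim_1_over_n] r, unfolded o_def])
  have det: "1 \<le> det (gram n m c G)"
    using LIMSEQ_le[OF lim_1 lim_det] less_imp_le[OF Xdet] by simp
  \<comment> \<open>At the limit the trace is \<open>n\<close> and the determinant at least 1, which
    is the rigid case of the trace-determinant inequality.\<close>
  have "gram n m c G = 1\<^sub>m n"
  proof (rule pos_def_eq_one[OF gram_pos_def[OF Gc c] _ det])
    show "(\<Sum>i<n. gram n m c G $$ (i, i)) = real n"
      using gram_trace_coisometry[of m G d n c, OF Gc GG] dim by simp
  qed (use det in auto)
  then have GG': "G \<in> BL_G m n d c"
    using Gm GG by (simp add: BL_G_def BL_geometric_def gram_def)
  obtain w where w: "\<And>A. A \<in> mtrans m n d \<Longrightarrow>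
    N A \<le> (\<Sum>(j, a, b)\<in>I. \<bar>A j $$ (a, b)\<bar> * w (j, a, b))"
    using mt_norm_entry_bound[OF assms(5)] unfolding I_def by blast
  have "(\<lambda>k. \<Sum>(j, a, b)\<in>I. \<bar>mt_diff m (X (r k)) G j $$ (a, b)\<bar> * w (j, a, b)) \<longlonglongrightarrow> (\<Sum>(j, a, b)\<in>I. 0)"
  proof (rule tendsto_sum)
    fix s assume "s \<in> I"
    then obtain j a b where s: "s = (j, a, b)" "j < m" "a < d j" "b < n" by (auto simp: I_def)
    have "(\<lambda>k. \<bar>X (r k) j $$ (a, b) - G j $$ (a, b)\<bar> * w s) \<longlonglongrightarrow> \<bar>G j $$ (a, b) - G j $$ (a, b)\<bar> * w s"
      using s by (intro tendsto_intros lim) auto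
    then show "(\<lambda>k. case s of (j, a, b) \<Rightarrow> \<bar>mt_diff m (X (r k)) G j $$ (a, b)\<bar> * w (j, a, b)) \<longlonglongrightarrow> (case s of (j, a, b) \<Rightarrow> 0)"
      using s Gc[OF s(2)] by (simp add: mt_diff_def)
  qed
  then have "(\<lambda>k. \<Sum>(j, a, b)\<in>I. \<bar>mt_diff m (X (r k)) G j $$ (a, b)\<bar> * w (j, a, b)) \<longlonglongrightarrow> 0"
    by (simp add: case_prod_unfold)
  from order_tendstoD(2)[OF this assms(7)] obtain k
    where k: "(\<Sum>(j, a, b)\<in>I. \<bar>mt_diff m (X (r k)) G j $$ (a, b)\<bar> * w (j, a, b)) < \<epsilon>"
    by (auto simp: eventually_sequentially)
  have "mt_diff m (X (r k)) G \<in> mtrans m n d" using Gc by (auto simp: mt_diff_def mtrans_def intro!: minus_carrier_mat)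
  from w[OF this] k have "N (mt_diff m (X (r k)) G) < \<epsilon>" by linarith
  with Xcl GG' show ?thesis by (intro bexI[of _ "X (r k)"] bexI[of _ G])
qed

end
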